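(* Let $1<t<3/2$ and let $\mathcal D$ be a dyadic system on $\mathbb T$. Let $\omega$ be a weight on $[0,1)$ for which there is a constant $c>0$ with $\omega(r)\ge c$ for all $r\in[0,1/2)$, and let $\omega(z):=\omega(|z|)$ denote the associated radial weight on $\mathbb D$. Assume further that $\omega\in\mathbf B_{\frac{1}{3-2t}}$. Then $\mathcal M_t^{\mathcal D}:L^{\frac{1}{3-2t}}(\mathbb D,\omega)\to L^1(\mathbb D)$ is bounded if and only if $$\sum_{k\ge0}2^k\int_{1-\frac1{2^k}}^{1-\frac1{2^{k+1}}}\frac{1}{\omega^{\frac{3-2t}{2t-2}}(r)}\,dr<+\infty .$$ In particular, $\mathcal M_t^{\mathcal D}$ is not bounded from $L^{\frac1{3-2t}}(\mathbb D)$ to $L^1(\mathbb D)$.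
   Context: $\mathbb D$ is the open unit disc in $\mathbb C$, $dA$ is normalized area measure on $\mathbb D$, $|E|$ denotes the $dA$-measure of $E\subseteq\mathbb D$. $\mathbb T$ is the unit circle with arc length normalized so that $|\mathbb T|=1$; $|I|$ is the normalized length of an arc $I$. A dyadic system on $\mathbb T$ is a collection of arcs $\mathcal D=\bigcup_{k\ge0}\mathcal D_k$ where each $\mathcal D_k$ consists of $2^k$ disjoint arcs of length $2^{-k}$ with union $\mathbb T$, and each arc of $\mathcal D_k$ is the union of two arcs of $\mathcal D_{k+1}$. The Carleson box of an arc $I\subseteq\mathbb T$ is $Q_I:=\{z\in\mathbb D: z/|z|\in I,\ 1-|I|\le|z|<1\}$ (the single point $z=0$ is a null set and plays no role). The dyadic hypersingular maximal operator is $$\mathcal M_t^{\mathcal D}f(z):=\sup_{I\in\mathcal D,\ z\in Q_I}\frac{1}{|Q_I|^t}\int_{Q_I}|f(w)|\,dA(w).$$ A weight is a nonnegative locally integrable function. $L^p(\mathbb D,\omega)$ is the space of measurable $f$ with $\|f\|_{L^p(\mathbb D,\omega)}^p:=\int_{\mathbb D}|f|^p\omega\,dA<\infty$; $L^p(\mathbb D)$ is the case $\omega\equiv1$. For $1<l<\infty$, a weight $\omega$ on $\mathbb D$ belongs to the Békollé–Bonami class $\mathbf B_l$ if $$\sup_{I\subseteq\mathbb T\text{ arc}}\left(\frac1{|Q_I|}\int_{Q_I}\omega\,dA\right)\left(\frac1{|Q_I|}\int_{Q_I}\omega^{-\frac1{l-1}}\,dA\right)^{l-1}<\infty .$$ 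*)

theory Defs
  imports "HOL-Analysis.Analysis"
begin

abbreviation unit_disc :: "complex set"
  where "unit_disc \<equiv> ball 0 1"

abbreviation unit_circle :: "complex set"
  where "unit_circle \<equiv> sphere 0 1"

definition disc_area :: "complex measure"
  where "disc_area = scale_measure (ennreal (1 / pi)) (lebesgue_on unit_disc)"

definition arc_length :: "complex set \<Rightarrow> real"
  where "arc_length I = measure lebesgue {x \<in> {0..<1}. cis (2 * pi * x) \<in> I}"

text \<open>
  Arcs may be open, closed or half-open, and the whole circle is an arc; single points are
  excluded by the requirement of positive length. The name avoids a clash with the predicate
  for injective paths in the library.
\<close>
definition circle_arc :: "complex set \<Rightarrow> bool"
  where "circle_arc I \<longleftrightarrow> I \<subseteq> unit_circle \<and> connected I \<and> 0 < arc_length I"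

definition dyadic_system :: "complex set set \<Rightarrow> bool"
  where "dyadic_system \<D> \<longleftrightarrow>
    (\<exists>\<D>k :: nat \<Rightarrow> complex set set.
      \<D> = (\<Union>k. \<D>k k) \<and>
      (\<forall>k. partition_on unit_circle (\<D>k k) \<and> card (\<D>k k) = 2 ^ k \<and>
        (\<forall>I \<in> \<D>k k. circle_arc I \<and> arc_length I = 1 / 2 ^ k \<and>
          (\<exists>J \<in> \<D>k (Suc k). \<exists>J' \<in> \<D>k (Suc k). J \<noteq> J' \<and> I = J \<union> J'))))"

text \<open>Since \<open>0 / 0 = 0\<close> does not lie on the circle, the origin belongs to no Carleson box.\<close>
definition carleson_box :: "complex set \<Rightarrow> complex set"
  where "carleson_box I =
    {z \<in> unit_disc. z / of_real (norm z) \<in> I \<and> 1 - arc_length I \<le> norm z \<and> norm z < 1}"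

definition hypersingular_maximal ::
    "complex set set \<Rightarrow> real \<Rightarrow> (complex \<Rightarrow> complex) \<Rightarrow> complex \<Rightarrow> ennreal"
  where "hypersingular_maximal \<D> t f z =
    (SUP I \<in> {I \<in> \<D>. z \<in> carleson_box I}.
      (\<integral>\<^sup>+w \<in> carleson_box I. ennreal (norm (f w)) \<partial>disc_area)
        / ennreal (measure disc_area (carleson_box I) powr t))"

text \<open>
  Local integrability on \<open>S\<close> is integrability over the compact subsets of \<open>S\<close>. Values outside
  of \<open>S\<close> are irrelevant.
\<close>
definition weight_on :: "'a::euclidean_space set \<Rightarrow> ('a \<Rightarrow> real) \<Rightarrow> bool"
  where "weight_on S \<omega> \<longleftrightarrow>
    (\<forall>x \<in> S. 0 \<le> \<omega> x) \<and> (\<forall>K. compact K \<and> K \<subseteq> S \<longrightarrow> \<omega> absolutely_integrable_on K)"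

text \<open>Powers of extended nonnegative reals, for exponents \<open>a > 0\<close> only.\<close>
definition ennpowr :: "ennreal \<Rightarrow> real \<Rightarrow> ennreal"
  where "ennpowr x a = (if x = \<infinity> then \<infinity> else ennreal (enn2real x powr a))"

text \<open>
  The negative power of the weight is the inverse in \<^typ>\<open>ennreal\<close> of a positive power, so that
  it is infinite (and not \<open>0\<close>, as \<open>0 powr a\<close> would be) where the weight vanishes.
\<close>
definition bekolle_bonami :: "real \<Rightarrow> (complex \<Rightarrow> real) set"
  where "bekolle_bonami l =
    {\<omega>. weight_on unit_disc \<omega> \<and>
      (SUP I \<in> {I. circle_arc I}.
        ((\<integral>\<^sup>+z \<in> carleson_box I. ennreal (\<omega> z) \<partial>disc_area)
            / emeasure disc_area (carleson_box I))
        * ennpowr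
            ((\<integral>\<^sup>+z \<in> carleson_box I. inverse (ennreal (\<omega> z powr (1 / (l - 1)))) \<partial>disc_area)
              / emeasure disc_area (carleson_box I))
            (l - 1)) < \<infinity>}"

definition Lp_norm :: "real \<Rightarrow> (complex \<Rightarrow> real) \<Rightarrow> (complex \<Rightarrow> ennreal) \<Rightarrow> ennreal"
  where "Lp_norm p \<omega> g = ennpowr (\<integral>\<^sup>+z. ennpowr (g z) p * ennreal (\<omega> z) \<partial>disc_area) (1 / p)"

definition Lp_space :: "real \<Rightarrow> (complex \<Rightarrow> real) \<Rightarrow> (complex \<Rightarrow> complex) set"
  where "Lp_space p \<omega> =
    {f \<in> borel_measurable disc_area. Lp_norm p \<omega> (\<lambda>z. ennreal (norm (f z))) < \<infinity>}"

text \<open>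
  Boundedness from weighted \<open>L\<^sup>p\<close> to unweighted \<open>L\<^sup>q\<close> of an operator with values in the
  \<open>[0, \<infinity>]\<close>-valued functions.
\<close>
definition bounded_Lp_Lq ::
    "real \<Rightarrow> (complex \<Rightarrow> real) \<Rightarrow> real \<Rightarrow> ((complex \<Rightarrow> complex) \<Rightarrow> complex \<Rightarrow> ennreal) \<Rightarrow> bool"
  where "bounded_Lp_Lq p \<omega> q T \<longleftrightarrow>
    (\<exists>C::real. \<forall>f \<in> Lp_space p \<omega>.
      T f \<in> borel_measurable disc_area \<and>
      Lp_norm q (\<lambda>_. 1) (T f) \<le> ennreal C * Lp_norm p \<omega> (\<lambda>z. ennreal (norm (f z))))"

end

theory Submission
  imports Defs
begin

text \<open>
  Put \<open>a = 2t - 2\<close>, so that \<open>0 < a < 1\<close> and \<open>p = 1 / (1 - a)\<close> has the conjugate exponent \<open>1 / a\<close>. Let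
  \<open>k\<close> be the level of \<open>z\<close>, that is, \<open>1 - 2^-k \<le> |z| < 1 - 2^-(k+1)\<close>. The theorem rests on a two-sided
  estimate that does not involve the weight: the integral of the maximal function of \<open>f\<close> is
  comparable to the integral of \<open>2^(ak) |f|\<close> (\<open>nn_integral_maximal_le\<close> and \<open>nn_integral_maximal_ge\<close>).
  A box \<open>Q\<close> of generation \<open>k\<close> and its upper half have areas comparable to \<open>4^-k\<close>, so \<open>Q\<close> is worth
  \<open>|Q|^(1-t)\<close>, roughly \<open>2^(ak)\<close>, times the integral of \<open>|f|\<close> over \<open>Q\<close>. From above, one adds up all
  boxes that contain a point; as \<open>a > 0\<close>, the smallest one dominates. From below, one keeps only the
  smallest one.

  Hence boundedness into \<open>L^1\<close> means that the linear functional with density \<open>2^(ak)\<close> is bounded on the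
  positive part of the weighted \<open>L^p\<close>. By duality this holds if and only if the integral of
  \<open>2^k \<omega>^(-(1-a)/a)\<close> over the disc is finite: \<open>bounded_if_dual_energy_finite\<close> is an application of
  Hoelder's inequality, and \<open>dual_energy_finite_if_bounded\<close> tests the truncated extremal function.

  For a radial weight, polar coordinates turn the dual integral into the series of the theorem, up to
  the density \<open>2r\<close>. The density is harmless away from the origin, and near the origin the weight is
  bounded below (\<open>dual_energy_radial_finite_iff\<close>). For the constant weight all terms of the series are
  \<open>1 / 2\<close>.

  The polar coordinate formula itself follows from the invariance of area under rotations: a function
  and its mean over all rotations have the same integral, and the mean is radial
  (\<open>nn_integral_polar_disc\<close>).
\<close>

section \<open>Rotation invariance of planar Lebesgue measure\<close>

lemma borel_measurable_Complex [measurable]: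
  assumes "f \<in> borel_measurable M" "g \<in> borel_measurable M"
  shows "(\<lambda>x. Complex (f x) (g x)) \<in> borel_measurable M"
  using assms by (simp add: borel_measurable_complex_iff)

lemma lborel_complex_conv_pair:
  "(lborel :: complex measure) = distr (lborel \<Otimes>\<^sub>M lborel) borel (\<lambda>(x, y). Complex x y)"
proof (rule lborel_eqI)
  fix l u :: complex
  assume le: "\<And>b. b \<in> Basis \<Longrightarrow> l \<bullet> b \<le> u \<bullet> b"
  have leRe: "Re l \<le> Re u" and leIm: "Im l \<le> Im u"
    using le[of 1] le[of \<i>] by (auto simp: Basis_complex_def)
  have "emeasure (distr (lborel \<Otimes>\<^sub>M lborel) borel (\<lambda>(x, y). Complex x y)) (box l u)
      = emeasure (lborel \<Otimes>\<^sub>M lborel) ({Re l<..<Re u} \<times> {Im l<..<Im u})"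
    by (subst emeasure_distr)
       (auto intro!: arg_cong[where f = "emeasure _"] simp: box_def Basis_complex_def space_pair_measure)
  also have "\<dots> = ennreal ((Re u - Re l) * (Im u - Im l))"
    using leRe leIm by (simp add: lborel.emeasure_pair_measure_Times ennreal_mult)
  also have "\<dots> = ennreal (\<Prod>b\<in>Basis. (u - l) \<bullet> b)"
    by (simp add: Basis_complex_def)
  finally show "emeasure (distr (lborel \<Otimes>\<^sub>M lborel) borel (\<lambda>(x, y). Complex x y)) (box l u)
      = (\<Prod>b\<in>Basis. (u - l) \<bullet> b)" .
qed simp

lemma nn_integral_lborel_complex:
  fixes f :: "complex \<Rightarrow> ennreal"
  assumes [measurable]: "f \<in> borel_measurable borel"
  shows "(\<integral>\<^sup>+z. f z \<partial>lborel) = (\<integral>\<^sup>+x. \<integral>\<^sup>+y. f (Complex x y) \<partial>lborel \<partial>lborel)"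
  by (subst lborel_complex_conv_pair)
     (simp add: nn_integral_distr lborel.nn_integral_fst[symmetric] split_beta)

lemma nn_integral_lborel_complex':
  fixes f :: "complex \<Rightarrow> ennreal"
  assumes [measurable]: "f \<in> borel_measurable borel"
  shows "(\<integral>\<^sup>+z. f z \<partial>lborel) = (\<integral>\<^sup>+y. \<integral>\<^sup>+x. f (Complex x y) \<partial>lborel \<partial>lborel)"
  unfolding nn_integral_lborel_complex[OF assms]
  by (rule lborel_pair.Fubini'[symmetric]) simp

lemma nn_integral_shear_Re:
  fixes f :: "complex \<Rightarrow> ennreal" and a :: real
  assumes [measurable]: "f \<in> borel_measurable borel"
  shows "(\<integral>\<^sup>+z. f (Complex (Re z + a * Im z) (Im z)) \<partial>lborel) = (\<integral>\<^sup>+z. f z \<partial>lborel)"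
proof -
  have "(\<integral>\<^sup>+x. f (Complex (x + a * y) y) \<partial>lborel) = (\<integral>\<^sup>+x. f (Complex x y) \<partial>lborel)" for y
    using nn_integral_real_affine[of "\<lambda>x. f (Complex x y)" 1 "a * y"] by (simp add: add.commute)
  then show ?thesis
    by (simp add: nn_integral_lborel_complex')
qed

lemma nn_integral_shear_Im:
  fixes f :: "complex \<Rightarrow> ennreal" and a :: real
  assumes [measurable]: "f \<in> borel_measurable borel"
  shows "(\<integral>\<^sup>+z. f (Complex (Re z) (Im z + a * Re z)) \<partial>lborel) = (\<integral>\<^sup>+z. f z \<partial>lborel)"
proof -
  have "(\<integral>\<^sup>+y. f (Complex x (y + a * x)) \<partial>lborel) = (\<integral>\<^sup>+y. f (Complex x y) \<partial>lborel)" for x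
    using nn_integral_real_affine[of "\<lambda>y. f (Complex x y)" 1 "a * x"] by (simp add: add.commute)
  then show ?thesis
    by (simp add: nn_integral_lborel_complex)
qed

text \<open>
  The rotation by the angle \<open>2h\<close> is a product of three shears, with the factors \<open>-tan h\<close>,
  \<open>sin 2h\<close> and \<open>-tan h\<close>. A shear preserves area because on each line parallel to an axis it is a
  translation. The angle \<open>2h = \<pi>\<close>, where the tangent has its pole, is left out.
\<close>
lemma nn_integral_lborel_cis_half:
  fixes f :: "complex \<Rightarrow> ennreal"
  assumes [measurable]: "f \<in> borel_measurable borel" and c: "cos h \<noteq> 0"
  shows "(\<integral>\<^sup>+z. f (cis (2 * h) * z) \<partial>lborel) = (\<integral>\<^sup>+z. f z \<partial>lborel)"
proof -
  define T where "T = - tan h"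
  define S where "S = sin (2 * h)"
  have TS: "1 + T * S = cos (2 * h)" and T2: "T * (2 + T * S) = - S"
  proof -
    have 1: "tan h * sin (2 * h) = 2 * (sin h)^2"
      using c by (simp add: tan_def sin_double power2_eq_square)
    show "1 + T * S = cos (2 * h)"
      by (simp add: T_def S_def 1 cos_double_sin)
    have "2 - 2 * (sin h)^2 = 2 * cos h * cos h"
      by (simp add: sin_squared_eq) (simp add: power2_eq_square)
    then have "tan h * (2 - 2 * (sin h)^2) = sin (2 * h)"
      using c by (simp add: tan_def sin_double)
    then show "T * (2 + T * S) = - S"
      using 1 by (simp add: T_def S_def algebra_simps)
  qed
  define g1 where "g1 z = f (Complex (Re z + T * Im z) (Im z))" for z
  have [measurable]: "g1 \<in> borel_measurable borel"
    unfolding g1_def by measurable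
  define g2 where "g2 z = g1 (Complex (Re z) (Im z + S * Re z))" for z
  have [measurable]: "g2 \<in> borel_measurable borel"
    unfolding g2_def by measurable
  have "f (cis (2 * h) * z) = g2 (Complex (Re z + T * Im z) (Im z))" for z
  proof -
    have "cos (2 * h) * Re z - S * Im z
        = (Re z + T * Im z) + T * (Im z + S * (Re z + T * Im z))"
    proof -
      have "(Re z + T * Im z) + T * (Im z + S * (Re z + T * Im z))
          = (1 + T * S) * Re z + (T * (2 + T * S)) * Im z"
        by (simp add: algebra_simps)
      then show ?thesis
        by (simp add: TS T2)
    qed
    moreover have "cos (2 * h) * Im z + S * Re z = Im z + S * (Re z + T * Im z)"
      unfolding TS[symmetric] by (simp add: algebra_simps)
    ultimately show ?thesis
      by (simp add: g2_def g1_def S_def complex_eq_iff mult.commute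
          arg_cong[where f = f] cis.ctr complex_mult add.commute)
  qed
  then have "(\<integral>\<^sup>+z. f (cis (2 * h) * z) \<partial>lborel) = (\<integral>\<^sup>+z. g2 z \<partial>lborel)"
    by (simp add: nn_integral_shear_Re)
  also have "\<dots> = (\<integral>\<^sup>+z. f z \<partial>lborel)"
    unfolding g2_def by (simp add: nn_integral_shear_Im) (simp add: g1_def nn_integral_shear_Re)
  finally show ?thesis .
qed

text \<open>
  The missing rotation by \<open>\<pi>\<close> is done in two steps.
\<close>
lemma nn_integral_lborel_rotate:
  fixes f :: "complex \<Rightarrow> ennreal"
  assumes [measurable]: "f \<in> borel_measurable borel"
  shows "(\<integral>\<^sup>+z. f (cis a * z) \<partial>lborel) = (\<integral>\<^sup>+z. f z \<partial>lborel)"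
proof (cases "cos (a / 2) = 0")
  case False
  from nn_integral_lborel_cis_half[OF assms this] show ?thesis by simp
next
  case True
  have c: "cos (a / 4) \<noteq> 0"
    using True cos_double_cos[of "a / 4"] by auto
  have "(\<integral>\<^sup>+z. f (cis a * z) \<partial>lborel) = (\<integral>\<^sup>+z. f (cis (a/2) * (cis (a/2) * z)) \<partial>lborel)"
    by (simp add: mult.assoc[symmetric] cis_mult)
  also have "\<dots> = (\<integral>\<^sup>+z. f (cis (a/2) * z) \<partial>lborel)"
    using nn_integral_lborel_cis_half[of "\<lambda>z. f (cis (a/2) * z)" "a/4"] c by simp
  also have "\<dots> = (\<integral>\<^sup>+z. f z \<partial>lborel)"
    using nn_integral_lborel_cis_half[of f "a/4"] c by simp
  finally show ?thesis .
qed


section \<open>Polar coordinates on the disc\<close>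

lemma nn_integral_periodic_shift:
  fixes h :: "real \<Rightarrow> ennreal"
  assumes [measurable]: "h \<in> borel_measurable borel"
    and per: "\<And>x. h (x + 1) = h x" and a: "0 \<le> a" "a \<le> 1"
  shows "(\<integral>\<^sup>+x\<in>{0..<1}. h (x + a) \<partial>lborel) = (\<integral>\<^sup>+x\<in>{0..<1}. h x \<partial>lborel)"
proof -
  have "(\<integral>\<^sup>+x\<in>{0..<1}. h (x + a) \<partial>lborel) = (\<integral>\<^sup>+x. h x * indicator {a..<1 + a} x \<partial>lborel)"
    by (subst nn_integral_real_affine[of "\<lambda>x. h x * indicator {a..<1 + a} x" 1 a])
       (auto intro!: nn_integral_cong simp: add.commute split: split_indicator)
  also have "\<dots> = (\<integral>\<^sup>+x. h x * indicator {a..<1} x + h x * indicator {1..<1 + a} x \<partial>lborel)"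
    using a by (intro nn_integral_cong) (auto split: split_indicator)
  also have "\<dots> = (\<integral>\<^sup>+x. h x * indicator {a..<1} x \<partial>lborel) + (\<integral>\<^sup>+x. h x * indicator {1..<1 + a} x \<partial>lborel)"
    by (rule nn_integral_add) auto
  also have "(\<integral>\<^sup>+x. h x * indicator {1..<1 + a} x \<partial>lborel) = (\<integral>\<^sup>+x. h x * indicator {0..<a} x \<partial>lborel)"
    by (subst nn_integral_real_affine[of _ 1 1])
       (auto intro!: nn_integral_cong simp: add.commute[of 1] per split: split_indicator)
  also have "(\<integral>\<^sup>+x. h x * indicator {a..<1} x \<partial>lborel) + (\<integral>\<^sup>+x. h x * indicator {0..<a} x \<partial>lborel)
      = (\<integral>\<^sup>+x. h x * indicator {a..<1} x + h x * indicator {0..<a} x \<partial>lborel)"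
    by (rule nn_integral_add[symmetric]) auto
  also have "\<dots> = (\<integral>\<^sup>+x\<in>{0..<1}. h x \<partial>lborel)"
    using a by (intro nn_integral_cong) (auto split: split_indicator)
  finally show ?thesis .
qed

text \<open>
  The radial part of the area measure: a disc of radius \<open>r\<close> has area \<open>\<pi>r\<^sup>2\<close>, which is the integral of
  \<open>2\<pi>s\<close> over \<open>0 \<le> s \<le> r\<close>.
\<close>
lemma distr_norm_disc:
  "distr (density lborel (indicator unit_disc)) borel (norm :: complex \<Rightarrow> real)
    = density lborel (\<lambda>r. ennreal (2 * pi * r) * indicator {0..<1} r)" (is "?M = ?N")
proof (rule measure_eqI_lessThan)
  fix x :: real
  \<comment> \<open>Both measures live on \<open>[0, 1)\<close>, so the threshold \<open>x\<close> may be cut off to \<open>m \<in> [0, 1]\<close>.\<close>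
  define m where "m = min 1 (max 0 x)"
  have m: "0 \<le> m" "m \<le> 1" by (auto simp: m_def)
  have [measurable]: "norm -` {x<..} \<in> sets (borel :: complex measure)"
    by (intro borel_open open_vimage open_greaterThan continuous_on_norm_id)
  have "emeasure ?M {x<..} = (\<integral>\<^sup>+z. indicator (ball 0 1) z * indicator (norm -` {x<..}) (z::complex) \<partial>lborel)"
    by (subst emeasure_distr, simp, simp, subst emeasure_density)
      (auto intro: borel_measurable_indicator)
  also have "\<dots> = (\<integral>\<^sup>+z. indicator (ball 0 1 - cball 0 m) (z::complex) \<partial>lborel)"
  proof (rule nn_integral_cong_AE)
    show "AE z in lborel. indicator (ball 0 1) z * indicator (norm -` {x<..}) z
        = (indicator (ball 0 1 - cball 0 m) (z::complex) :: ennreal)"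
      using AE_lborel_singleton[of 0]
    proof eventually_elim
      case (elim z)
      have "norm z > 0" using elim by simp
      then have "z \<in> ball 0 1 \<and> x < norm z \<longleftrightarrow> z \<in> ball 0 1 - cball 0 m"
        by (cases "x < 0") (auto simp: m_def intro: less_le_trans[OF _ norm_ge_zero])
      then show ?case
        by (auto split: split_indicator)
    qed
  qed
  also have "\<dots> = emeasure lborel (ball 0 1 - cball 0 m :: complex set)"
    by simp
  also have "\<dots> = emeasure lborel (ball 0 1 :: complex set) - emeasure lborel (cball 0 m :: complex set)"
  proof (cases "m = 1")
    case False
    with m show ?thesis by (intro emeasure_Diff) (auto simp: emeasure_cball)
  qed (simp add: emeasure_cball emeasure_ball ball_subset_cball Diff_eq_empty_iff[THEN iffD2])
  also have "\<dots> = ennreal (pi - pi * m\<^sup>2)"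
    using m by (simp add: emeasure_ball emeasure_cball unit_ball_vol_2 ennreal_minus)
  finally have 1: "emeasure ?M {x<..} = ennreal (pi - pi * m\<^sup>2)" .
  have "emeasure ?N {x<..} = (\<integral>\<^sup>+r. ennreal (2 * pi * r) * indicator {m..1} r \<partial>lborel)"
  proof -
    have "AE r in lborel. r \<noteq> m \<and> r \<noteq> (1::real)"
      using AE_lborel_singleton[of m] AE_lborel_singleton[of 1] by eventually_elim auto
    then have "AE r in lborel. ennreal (2 * pi * r) * indicator {0..<1} r * indicator {x<..} r
       = ennreal (2 * pi * r) * indicator {m..1} r"
      by eventually_elim (auto simp: m_def split: split_indicator)
    then show ?thesis
      by (simp add: emeasure_density nn_integral_cong_AE)
  qed
  also have "\<dots> = ennreal (pi * 1\<^sup>2 - pi * m\<^sup>2)"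
    using m by (intro nn_integral_FTC_Icc[where F = "\<lambda>r. pi * r\<^sup>2"])
       (auto intro!: derivative_eq_intros)
  finally have 2: "emeasure ?N {x<..} = ennreal (pi - pi * m\<^sup>2)"
    by simp
  show "emeasure ?M {x<..} = emeasure ?N {x<..}"
    by (simp only: 1 2)
  show "emeasure ?M {x<..} < \<infinity>"
    by (simp only: 1) simp
qed simp_all

text \<open>
  By rotation invariance the integral of \<open>f\<close> equals that of its mean over all rotations. The mean
  depends on \<open>|z|\<close> only, so the law of the norm finishes the computation. This avoids a change of
  variables in two dimensions.
\<close>
lemma nn_integral_polar_disc:
  fixes f :: "complex \<Rightarrow> ennreal"
  assumes [measurable]: "f \<in> borel_measurable borel"
  shows "(\<integral>\<^sup>+z\<in>ball 0 1. f z \<partial>lborel)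
    = (\<integral>\<^sup>+r\<in>{0..<1}. ennreal (2 * pi * r) * (\<integral>\<^sup>+x\<in>{0..<1}. f (of_real r * cis (2 * pi * x)) \<partial>lborel) \<partial>lborel)"
proof -
  define H where "H r = (\<integral>\<^sup>+x\<in>{0..<1}. f (of_real r * cis (2 * pi * x)) \<partial>lborel)" for r
  have [measurable]: "H \<in> borel_measurable borel"
    unfolding H_def cis.ctr by measurable
  have [measurable]: "ball (0::complex) 1 \<in> sets borel" "{0..<1::real} \<in> sets borel"
    by simp_all
  have mean: "(\<integral>\<^sup>+x\<in>{0..<1}. f (cis (2 * pi * x) * z) \<partial>lborel) = H (norm z)" for z
  proof -
    define a where "a = Arg2pi z / (2 * pi)"
    have a: "0 \<le> a" "a \<le> 1"
      using Arg2pi_ge_0[of z] Arg2pi_lt_2pi[of z] by (auto simp: a_def)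
    have z: "z = of_real (norm z) * cis (2 * pi * a)"
      using Arg2pi_eq[of z] by (simp add: a_def cis_conv_exp)
    have "f (cis (2 * pi * x) * z) = f (of_real (norm z) * cis (2 * pi * (x + a)))" for x
      by (subst z) (simp add: algebra_simps cis_mult[symmetric])
    then have "(\<integral>\<^sup>+x\<in>{0..<1}. f (cis (2 * pi * x) * z) \<partial>lborel)
       = (\<integral>\<^sup>+x\<in>{0..<1}. f (of_real (norm z) * cis (2 * pi * (x + a))) \<partial>lborel)"
      by simp
    also have "\<dots> = H (norm z)"
      unfolding H_def
    proof (rule nn_integral_periodic_shift[OF _ _ a])
      show "(\<lambda>x. f (of_real (norm z) * cis (2 * pi * x))) \<in> borel_measurable borel"
        unfolding cis.ctr by measurable
    next
      fix x :: real
      have "cis (2 * pi * (x + 1)) = cis (2 * pi * x)"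
        by (simp add: distrib_left flip: cis_mult)
      then show "f (of_real (norm z) * cis (2 * pi * (x + 1))) = f (of_real (norm z) * cis (2 * pi * x))"
        by simp
    qed
    finally show ?thesis .
  qed
  have "(\<integral>\<^sup>+z\<in>ball 0 1. f z \<partial>lborel)
     = (\<integral>\<^sup>+x\<in>{0..<1::real}. (\<integral>\<^sup>+z\<in>ball 0 1. f z \<partial>lborel) \<partial>lborel)"
    by (simp add: nn_integral_cmult)
  also have "\<dots> = (\<integral>\<^sup>+x\<in>{0..<1}. (\<integral>\<^sup>+z. f (cis (2 * pi * x) * z) * indicator (ball 0 1) z \<partial>lborel) \<partial>lborel)"
  proof (rule nn_integral_cong)
    fix x :: real
    have "(\<integral>\<^sup>+z\<in>ball 0 1. f z \<partial>lborel) = (\<integral>\<^sup>+z. f (cis (2 * pi * x) * z) * indicator (ball 0 1) z \<partial>lborel)"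
      using nn_integral_lborel_rotate[of "\<lambda>z. f z * indicator (ball 0 1) z" "2 * pi * x"]
      by (simp add: indicator_def norm_mult)
    then show "(\<integral>\<^sup>+z\<in>ball 0 1. f z \<partial>lborel) * indicator {0..<1} x
        = (\<integral>\<^sup>+z. f (cis (2 * pi * x) * z) * indicator (ball 0 1) z \<partial>lborel) * indicator {0..<1} x"
      by simp
  qed
  also have "\<dots> = (\<integral>\<^sup>+x. (\<integral>\<^sup>+z. f (cis (2 * pi * x) * z) * indicator (ball 0 1) z * indicator {0..<1} x \<partial>lborel) \<partial>lborel)"
    by (rule nn_integral_cong) (simp split: split_indicator)
  also have "\<dots> = (\<integral>\<^sup>+z. (\<integral>\<^sup>+x. f (cis (2 * pi * x) * z) * indicator (ball 0 1) z * indicator {0..<1} x \<partial>lborel) \<partial>lborel)"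
    unfolding cis.ctr by (rule lborel_pair.Fubini') measurable
  also have "\<dots> = (\<integral>\<^sup>+z. (\<integral>\<^sup>+x. f (cis (2 * pi * x) * z) * indicator {0..<1} x \<partial>lborel) * indicator (ball 0 1) z \<partial>lborel)"
    by (rule nn_integral_cong) (simp split: split_indicator)
  also have "\<dots> = (\<integral>\<^sup>+z. H (norm z) * indicator unit_disc z \<partial>lborel)"
    by (simp add: mean)
  also have "\<dots> = (\<integral>\<^sup>+r. H r \<partial>distr (density lborel (indicator unit_disc)) borel norm)"
    by (simp add: nn_integral_distr nn_integral_density mult.commute)
  also have "\<dots> = (\<integral>\<^sup>+r\<in>{0..<1}. ennreal (2 * pi * r) * H r \<partial>lborel)"
    by (simp add: distr_norm_disc nn_integral_density mult_ac)
  finally show ?thesis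
    by (simp only: H_def)
qed

text \<open>
  The argument measured in full turns, so that a set of arguments has the same normalized length as
  its arc. The value at the origin is \<open>0\<close>.
\<close>
definition turn :: "complex \<Rightarrow> real" where "turn z = Arg2pi z / (2 * pi)"

lemma turn_range: "turn z \<in> {0..<1}"
  using Arg2pi_ge_0[of z] Arg2pi_lt_2pi[of z] by (auto simp: turn_def)

lemma cis_turn: "z \<noteq> 0 \<Longrightarrow> cis (2 * pi * turn z) = z / of_real (norm z)"
  using Arg2pi_eq[of z] by (simp add: turn_def cis_conv_exp field_simps)

lemma turn_eq: "0 < r \<Longrightarrow> x \<in> {0..<1} \<Longrightarrow> turn (of_real r * cis (2 * pi * x)) = x"
  unfolding turn_def by (subst Arg2pi_unique[of r "2 * pi * x"]) (auto simp: cis_conv_exp)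

lemma borel_measurable_turn [measurable]: "turn \<in> borel_measurable borel"
proof -
  have "Arg2pi \<in> borel_measurable borel"
    by (subst borel_measurable_iff_greater) (simp add: borel_open open_Arg2pi2pi_gt)
  then show ?thesis
    unfolding turn_def[abs_def] by measurable
qed

lemma sets_disc_area [measurable_cong]: "sets disc_area = sets (lebesgue_on unit_disc)"
  by (simp add: disc_area_def)

lemma space_disc_area: "space disc_area = unit_disc"
  by (simp add: disc_area_def space_scale_measure)

lemma nn_integral_disc_area:
  assumes "f \<in> borel_measurable disc_area"
  shows "(\<integral>\<^sup>+z. f z \<partial>disc_area) = ennreal (1 / pi) * (\<integral>\<^sup>+z\<in>unit_disc. f z \<partial>lebesgue)"
  using assms unfolding disc_area_def
  by (simp add: nn_integral_scale_measure nn_integral_restrict_space)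

lemma borel_measurable_disc_area_borel:
  "f \<in> borel_measurable borel \<Longrightarrow> f \<in> borel_measurable disc_area"
  unfolding measurable_cong_sets[OF sets_disc_area refl]
  by (intro measurable_restrict_space1 measurable_completion) simp

text \<open>
  Under the normalized area, modulus and argument are independent. For Borel functions this is the
  polar coordinate formula; the Lebesgue measurable case follows below by modification on null sets.
\<close>
lemma nn_integral_disc_area_prod_borel:
  fixes F G :: "real \<Rightarrow> ennreal"
  assumes [measurable]: "F \<in> borel_measurable borel" "G \<in> borel_measurable borel"
  shows "(\<integral>\<^sup>+z. F (norm z) * G (turn z) \<partial>disc_area)
     = (\<integral>\<^sup>+r\<in>{0..<1}. F r * ennreal (2 * r) \<partial>lborel) * (\<integral>\<^sup>+x\<in>{0..<1}. G x \<partial>lborel)"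
proof -
  have "(\<integral>\<^sup>+z. F (norm z) * G (turn z) \<partial>disc_area)
     = ennreal (1 / pi) * (\<integral>\<^sup>+z\<in>unit_disc. F (norm z) * G (turn z) \<partial>lborel)"
    by (subst nn_integral_disc_area)
       (simp_all add: borel_measurable_disc_area_borel nn_integral_completion)
  also have "(\<integral>\<^sup>+z\<in>unit_disc. F (norm z) * G (turn z) \<partial>lborel)
      = (\<integral>\<^sup>+r\<in>{0..<1}. ennreal (2 * pi * r) * (\<integral>\<^sup>+x\<in>{0..<1}. F r * G x \<partial>lborel) \<partial>lborel)"
  proof (subst nn_integral_polar_disc, measurable, rule nn_integral_cong_AE)
    show "AE r in lborel.
        ennreal (2 * pi * r) * (\<integral>\<^sup>+x\<in>{0..<1}. F (norm (of_real r * cis (2 * pi * x)))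
           * G (turn (of_real r * cis (2 * pi * x))) \<partial>lborel) * indicator {0..<1} r
      = ennreal (2 * pi * r) * (\<integral>\<^sup>+x\<in>{0..<1}. F r * G x \<partial>lborel) * indicator {0..<1} r"
      using AE_lborel_singleton[of "0::real"]
    proof eventually_elim
      case (elim r)
      show ?case
      proof (cases "r \<in> {0..<1}")
        case True
        with elim have "(\<integral>\<^sup>+x\<in>{0..<1}. F (norm (of_real r * cis (2 * pi * x)))
             * G (turn (of_real r * cis (2 * pi * x))) \<partial>lborel) = (\<integral>\<^sup>+x\<in>{0..<1}. F r * G x \<partial>lborel)"
          by (intro nn_integral_cong) (auto simp: norm_mult turn_eq split: split_indicator)
        then show ?thesis by simp
      qed simp
    qed
  qed
  also have "\<dots> = (\<integral>\<^sup>+r. ennreal pi * (F r * ennreal (2 * r) * indicator {0..<1} r) * (\<integral>\<^sup>+x\<in>{0..<1}. G x \<partial>lborel) \<partial>lborel)"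
    by (intro nn_integral_cong)
       (auto simp: nn_integral_cmult mult.assoc ennreal_mult' ac_simps split: split_indicator)
  also have "\<dots> = ennreal pi * ((\<integral>\<^sup>+r\<in>{0..<1}. F r * ennreal (2 * r) \<partial>lborel) * (\<integral>\<^sup>+x\<in>{0..<1}. G x \<partial>lborel))"
    by (subst nn_integral_multc, measurable, subst nn_integral_cmult, measurable, simp add: mult.assoc)
  finally show ?thesis
    by (simp add: mult.assoc[symmetric] ennreal_mult[symmetric])
qed

lemma null_sets_disc_area:
  "A \<in> null_sets disc_area \<longleftrightarrow> A \<in> null_sets lebesgue \<and> A \<subseteq> unit_disc"
proof -
  have "A \<in> null_sets disc_area \<longleftrightarrow> A \<in> null_sets (lebesgue_on unit_disc)"
    by (simp add: null_sets_def disc_area_def ennreal_zero_less_divide)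
  then show ?thesis
    using null_sets_restrict_space[of unit_disc lebesgue] by auto
qed

interpretation disc_area: complete_measure disc_area
proof
  fix A B assume "B \<subseteq> A" "A \<in> null_sets disc_area"
  then have "B \<in> null_sets disc_area"
    unfolding null_sets_disc_area by (blast intro: null_sets_completion_subset)
  then show "B \<in> sets disc_area" by auto
qed

text \<open>
  Annuli over null sets of radii and sectors over null sets of arguments are null. This is what
  allows Lebesgue measurable (and not only Borel) radial weights and arcs.
\<close>
lemma null_sets_distr_polar:
  "null_sets lborel \<subseteq> null_sets (distr disc_area lborel norm)" (is ?norm)
  "null_sets lborel \<subseteq> null_sets (distr disc_area lborel turn)" (is ?turn)
proof -
  show ?norm
  proof
    fix A :: "real set" assume A: "A \<in> null_sets lborel"
    then have [measurable]: "A \<in> sets borel" by auto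
    have "emeasure (distr disc_area lborel norm) A = (\<integral>\<^sup>+z. indicator A (norm z) * 1 \<partial>disc_area)"
      by (subst nn_integral_indicator[symmetric], simp, subst nn_integral_distr)
         (simp_all add: borel_measurable_disc_area_borel)
    also have "\<dots> = 0"
    proof (subst nn_integral_disc_area_prod_borel)
      have "AE r in lborel. r \<notin> A" by (rule AE_not_in[OF A])
      then have "AE r in lborel. indicator A r * ennreal (2 * r) * indicator {0..<1} r = (0::ennreal)"
        by eventually_elim simp
      then have "(\<integral>\<^sup>+r\<in>{0..<1}. indicator A r * ennreal (2 * r) \<partial>lborel) = 0"
        by (simp add: nn_integral_0_iff_AE)
      then show "(\<integral>\<^sup>+r\<in>{0..<1}. indicator A r * ennreal (2 * r) \<partial>lborel) * (\<integral>\<^sup>+x\<in>{0..<1}. 1 \<partial>lborel) = 0"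
        by simp
    qed simp_all
    finally show "A \<in> null_sets (distr disc_area lborel norm)" by auto
  qed
  show ?turn
  proof
    fix A :: "real set" assume A: "A \<in> null_sets lborel"
    then have [measurable]: "A \<in> sets borel" by auto
    have "emeasure (distr disc_area lborel turn) A = (\<integral>\<^sup>+z. 1 * indicator A (turn z) \<partial>disc_area)"
      by (subst nn_integral_indicator[symmetric], simp, subst nn_integral_distr)
         (simp_all add: borel_measurable_disc_area_borel)
    also have "\<dots> = 0"
    proof (subst nn_integral_disc_area_prod_borel)
      have "AE x in lborel. x \<notin> A" by (rule AE_not_in[OF A])
      then have "AE x in lborel. indicator A x * indicator {0..<1} x = (0::ennreal)"
        by eventually_elim simp
      then have "(\<integral>\<^sup>+x\<in>{0..<1}. indicator A x \<partial>lborel) = 0"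
        by (simp add: nn_integral_0_iff_AE)
      then show "(\<integral>\<^sup>+r\<in>{0..<1}. 1 * ennreal (2 * r) \<partial>lborel) * (\<integral>\<^sup>+x\<in>{0..<1}. indicator A x \<partial>lborel) = 0"
        by simp
    qed simp_all
    finally show "A \<in> null_sets (distr disc_area lborel turn)" by auto
  qed
qed

lemma measurable_polar_lebesgue [measurable]:
  "norm \<in> disc_area \<rightarrow>\<^sub>M lebesgue" "turn \<in> disc_area \<rightarrow>\<^sub>M lebesgue"
  using disc_area.measurable_completion2[OF _ null_sets_distr_polar(1)]
    disc_area.measurable_completion2[OF _ null_sets_distr_polar(2)]
  by (simp_all add: borel_measurable_disc_area_borel)

lemma AE_disc_area_polar:
  assumes "AE x in lborel. P x"
  shows "AE z in disc_area. P (norm z)" "AE z in disc_area. P (turn z)"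
proof -
  obtain N where "{x \<in> space lborel. \<not> P x} \<subseteq> N" "emeasure lborel N = 0" "N \<in> sets lborel"
    using AE_E[OF assms] by metis
  then have N: "N \<in> null_sets lborel" "{x. \<not> P x} \<subseteq> N"
    by auto
  then have "N \<in> null_sets (distr disc_area lborel norm)" "N \<in> null_sets (distr disc_area lborel turn)"
    using null_sets_distr_polar by auto
  then have "norm -` N \<inter> space disc_area \<in> null_sets disc_area" "turn -` N \<inter> space disc_area \<in> null_sets disc_area"
    by (simp_all add: null_sets_distr_iff borel_measurable_disc_area_borel)
  then show "AE z in disc_area. P (norm z)" "AE z in disc_area. P (turn z)"
    using N(2) by (blast intro: AE_I')+
qed

text \<open>
  Both sides are unchanged if \<open>F\<close> and \<open>G\<close> are replaced by Borel functions that agree with them almost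
  everywhere.
\<close>
lemma nn_integral_disc_area_prod:
  fixes F G :: "real \<Rightarrow> ennreal"
  assumes F: "F \<in> borel_measurable lebesgue" and G: "G \<in> borel_measurable lebesgue"
  shows "(\<integral>\<^sup>+z. F (norm z) * G (turn z) \<partial>disc_area)
     = (\<integral>\<^sup>+r\<in>{0..<1}. F r * ennreal (2 * r) \<partial>lebesgue) * (\<integral>\<^sup>+x\<in>{0..<1}. G x \<partial>lebesgue)"
proof -
  obtain F' where F'[measurable]: "F' \<in> borel_measurable borel" and eF: "AE r in lborel. F r = F' r"
    using completion_ex_borel_measurable[OF F] by auto
  obtain G' where G'[measurable]: "G' \<in> borel_measurable borel" and eG: "AE r in lborel. G r = G' r"
    using completion_ex_borel_measurable[OF G] by auto
  have "(\<integral>\<^sup>+z. F (norm z) * G (turn z) \<partial>disc_area) = (\<integral>\<^sup>+z. F' (norm z) * G' (turn z) \<partial>disc_area)"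
  proof (rule nn_integral_cong_AE)
    show "AE z in disc_area. F (norm z) * G (turn z) = F' (norm z) * G' (turn z)"
      using AE_disc_area_polar(1)[OF eF] AE_disc_area_polar(2)[OF eG] by eventually_elim simp
  qed
  also have "\<dots> = (\<integral>\<^sup>+r\<in>{0..<1}. F' r * ennreal (2 * r) \<partial>lborel) * (\<integral>\<^sup>+x\<in>{0..<1}. G' x \<partial>lborel)"
    by (rule nn_integral_disc_area_prod_borel) simp_all
  also have "(\<integral>\<^sup>+r\<in>{0..<1}. F' r * ennreal (2 * r) \<partial>lborel) = (\<integral>\<^sup>+r\<in>{0..<1}. F r * ennreal (2 * r) \<partial>lborel)"
    using eF by (intro nn_integral_cong_AE) auto
  also have "(\<integral>\<^sup>+x\<in>{0..<1}. G' x \<partial>lborel) = (\<integral>\<^sup>+x\<in>{0..<1}. G x \<partial>lborel)"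
    using eG by (intro nn_integral_cong_AE) auto
  finally show ?thesis
    by (simp add: nn_integral_completion)
qed

lemma AE_disc_area_nonzero: "AE z in disc_area. z \<noteq> 0"
  using AE_disc_area_polar(1)[OF AE_lborel_singleton[of 0]] by simp

lemma nn_integral_disc_area_radial:
  fixes F :: "real \<Rightarrow> ennreal"
  assumes "F \<in> borel_measurable lebesgue"
  shows "(\<integral>\<^sup>+z. F (norm z) \<partial>disc_area) = (\<integral>\<^sup>+r\<in>{0..<1}. F r * ennreal (2 * r) \<partial>lebesgue)"
  using nn_integral_disc_area_prod[OF assms, of "\<lambda>_. 1"] by simp


text \<open>
  Carleson boxes and their upper halves are both of this form.
\<close>
definition sector :: "complex set \<Rightarrow> real \<Rightarrow> real \<Rightarrow> complex set"
  where "sector I a b = {z. z / of_real (norm z) \<in> I \<and> a \<le> norm z \<and> norm z < b}"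

text \<open>
  An arc has positive length by definition, whereas \<^const>\<open>measure\<close> vanishes outside of the
  \<open>\<sigma>\<close>-algebra. Hence the set of arguments of an arc is Lebesgue measurable, and so are sectors.
\<close>
lemma
  assumes I: "circle_arc I" and ab: "0 \<le> a" "a \<le> b" "b \<le> 1"
  shows sets_sector: "sector I a b \<in> sets disc_area"
    and emeasure_sector: "emeasure disc_area (sector I a b) = ennreal (arc_length I * (b\<^sup>2 - a\<^sup>2))"
proof -
  define X where "X = {x \<in> {0..<1}. cis (2 * pi * x) \<in> I}"
  have len: "arc_length I = measure lebesgue X" and pos: "0 < arc_length I" and I1: "I \<subseteq> unit_circle"
    using I by (simp_all only: arc_length_def X_def circle_arc_def)
  have X[measurable]: "X \<in> sets lebesgue"
  proof (rule ccontr)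
    assume "X \<notin> sets lebesgue"
    then show False
      using pos by (simp add: len measure_notin_sets)
  qed
  have "emeasure lebesgue X \<le> emeasure lebesgue {0..<1::real}"
    by (intro emeasure_mono) (auto simp: X_def)
  then have fin: "emeasure lebesgue X \<noteq> \<infinity>"
    by (auto simp: top_unique)
  have eq: "sector I a b = ((\<lambda>z. norm z) -` {a..<b} \<inter> space disc_area) \<inter> (turn -` X \<inter> space disc_area) - {0}"
  proof -
    have "0 \<notin> I" using I1 by auto
    moreover have "turn z \<in> X \<longleftrightarrow> z / of_real (norm z) \<in> I" if "z \<noteq> 0" for z
      using turn_range[of z] cis_turn[OF that] by (simp add: X_def)
    ultimately have "z \<in> sector I a b \<longleftrightarrow> norm z \<in> {a..<b} \<and> z \<in> space disc_area \<and> turn z \<in> X \<and> z \<noteq> 0" for z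
      using ab by (cases "z = 0") (auto simp: sector_def space_disc_area)
    then show ?thesis
      by (intro set_eqI) (simp only: Diff_iff Int_iff vimage_eq singleton_iff, blast)
  qed
  have "{0} \<in> sets disc_area"
    by (auto simp: sets_disc_area sets_restrict_space)
  moreover have "{a..<b} \<in> sets lebesgue" by simp
  ultimately show sec: "sector I a b \<in> sets disc_area"
    unfolding eq by (intro sets.Diff sets.Int measurable_sets[OF measurable_polar_lebesgue(1)]
        measurable_sets[OF measurable_polar_lebesgue(2)] X)
  have "emeasure disc_area (sector I a b) = (\<integral>\<^sup>+z. indicator (sector I a b) z \<partial>disc_area)"
    using sec by simp
  also have "\<dots> = (\<integral>\<^sup>+z. indicator {a..<b} (norm z) * indicator X (turn z) \<partial>disc_area)"
  proof (rule nn_integral_cong_AE)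
    show "AE z in disc_area. (indicator (sector I a b) z :: ennreal) = indicator {a..<b} (norm z) * indicator X (turn z)"
      using AE_disc_area_nonzero AE_space
      by eventually_elim (auto simp: eq split: split_indicator)
  qed
  also have "\<dots> = (\<integral>\<^sup>+r\<in>{0..<1}. indicator {a..<b} r * ennreal (2 * r) \<partial>lebesgue) * (\<integral>\<^sup>+x\<in>{0..<1}. indicator X x \<partial>lebesgue)"
    by (intro nn_integral_disc_area_prod borel_measurable_indicator X) simp
  also have "(\<integral>\<^sup>+x\<in>{0..<1}. indicator X x \<partial>lebesgue) = (\<integral>\<^sup>+x. indicator X x \<partial>lebesgue)"
    by (intro nn_integral_cong) (auto simp: X_def split: split_indicator)
  also have "\<dots> = ennreal (arc_length I)"
    using fin by (simp add: len emeasure_eq_ennreal_measure)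
  also have "(\<integral>\<^sup>+r\<in>{0..<1}. indicator {a..<b} r * ennreal (2 * r) \<partial>lebesgue) = (\<integral>\<^sup>+r. ennreal (2 * r) * indicator {a..b} r \<partial>lborel)"
    unfolding nn_integral_completion
  proof (rule nn_integral_cong_AE)
    show "AE r in lborel. indicator {a..<b} r * ennreal (2 * r) * indicator {0..<1} r = ennreal (2 * r) * indicator {a..b} r"
      using AE_lborel_singleton[of b] by eventually_elim (use ab in \<open>auto split: split_indicator\<close>)
  qed
  also have "\<dots> = ennreal (b\<^sup>2 - a\<^sup>2)"
    using ab by (intro nn_integral_FTC_Icc[where F = "\<lambda>r. r\<^sup>2"]) (auto intro!: derivative_eq_intros)
  finally show "emeasure disc_area (sector I a b) = ennreal (arc_length I * (b\<^sup>2 - a\<^sup>2))"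
    using ab pos by (simp add: ennreal_mult[symmetric] mult.commute power_mono)
qed


section \<open>Dyadic layers and Carleson boxes\<close>

text \<open>
  The number \<open>k\<close> of the layer \<open>1 - 2^-k \<le> r < 1 - 2^-(k+1)\<close> that contains \<open>r\<close>. A point
  \<open>z \<noteq> 0\<close> of the disc lies in exactly one box of each generation up to the level of \<open>|z|\<close>, and in no
  later one.
\<close>
definition dyadic_level :: "real \<Rightarrow> nat"
  where "dyadic_level r = nat \<lfloor>- log 2 (1 - r)\<rfloor>"

lemma le_dyadic_level_iff:
  assumes "0 \<le> r" "r < 1"
  shows "k \<le> dyadic_level r \<longleftrightarrow> 1 - 1 / 2 ^ k \<le> r"
proof -
  have "0 \<le> - log 2 (1 - r)"
    using assms by (simp add: log_le_zero_cancel_iff)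
  then have "k \<le> dyadic_level r \<longleftrightarrow> real k \<le> - log 2 (1 - r)"
    by (simp add: dyadic_level_def le_nat_iff le_floor_iff)
  also have "\<dots> \<longleftrightarrow> log 2 (1 - r) \<le> - real k"
    by linarith
  also have "\<dots> \<longleftrightarrow> 1 - r \<le> 2 powr (- real k)"
    using assms by (subst log_le_iff) auto
  also have "2 powr (- real k) = 1 / 2 ^ k"
    by (simp add: powr_minus_divide powr_realpow)
  finally show ?thesis by auto
qed

lemma measurable_dyadic_level [measurable]: "dyadic_level \<in> borel \<rightarrow>\<^sub>M count_space UNIV"
  unfolding dyadic_level_def[abs_def] by measurable

lemma measurable_dyadic_level_norm [measurable]:
  "(\<lambda>z. dyadic_level (norm z)) \<in> disc_area \<rightarrow>\<^sub>M count_space UNIV"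
  using measurable_compose[OF borel_measurable_disc_area_borel measurable_dyadic_level, of norm] by simp

text \<open>
  The function \<open>2^(a k)\<close> on the layer of level \<open>k\<close>, which is comparable to \<open>(1 - |z|)^(-a)\<close>.
\<close>
definition level_weight :: "real \<Rightarrow> complex \<Rightarrow> ennreal"
  where "level_weight a z = ennreal (2 powr (a * real (dyadic_level (norm z))))"

lemma borel_measurable_level_weight [measurable]: "level_weight a \<in> borel_measurable disc_area"
  unfolding level_weight_def[abs_def] by measurable

lemma emeasure_disc_area_finite: "emeasure disc_area (space disc_area) < \<infinity>"
proof -
  have "emeasure disc_area (space disc_area) = ennreal (1 / pi) * emeasure lborel unit_disc"
    by (simp add: disc_area_def space_scale_measure emeasure_restrict_space)
  then show ?thesis
    by (simp add: ennreal_mult_less_top emeasure_ball)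
qed

lemma space_disc_area_iff: "z \<in> space disc_area \<longleftrightarrow> norm z < 1"
  by (simp add: space_disc_area)

text \<open>
  The areas of a Carleson box of generation \<open>k\<close> and of its upper half, the part in the layer of
  level \<open>k\<close>. Both are comparable to \<open>4^-k\<close>.
\<close>
definition box_area :: "nat \<Rightarrow> real"
  where "box_area k = 1 / 2 ^ k * (1 - (1 - 1 / 2 ^ k)\<^sup>2)"

definition half_box_area :: "nat \<Rightarrow> real"
  where "half_box_area k = 1 / 2 ^ k * ((1 - 1 / 2 ^ Suc k)\<^sup>2 - (1 - 1 / 2 ^ k)\<^sup>2)"

lemma box_area_bounds: "1 / 4 ^ k \<le> box_area k" "box_area k \<le> 2 / 4 ^ k"
proof -
  define x :: real where "x = 1 / 2 ^ k"
  have x: "0 < x" "x \<le> 1" by (auto simp: x_def)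
  have e: "box_area k = x\<^sup>2 * (2 - x)"
    by (simp add: box_area_def x_def[symmetric] power2_eq_square algebra_simps)
  have x2: "x\<^sup>2 = 1 / 4 ^ k"
    by (simp add: x_def power_divide power2_eq_square flip: power_mult_distrib)
  have "x\<^sup>2 * 1 \<le> x\<^sup>2 * (2 - x)" "x\<^sup>2 * (2 - x) \<le> x\<^sup>2 * 2"
    using x by (intro mult_left_mono; simp)+
  then show "1 / 4 ^ k \<le> box_area k" "box_area k \<le> 2 / 4 ^ k"
    by (simp_all add: e x2)
qed

lemma box_area_pos: "0 < box_area k"
  by (rule less_le_trans[OF _ box_area_bounds(1)]) simp

lemma half_box_area_ge: "1 / 4 * (1 / 4 ^ k) \<le> half_box_area k"
proof -
  define x :: real where "x = 1 / 2 ^ k"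
  have x: "0 < x" "x \<le> 1" by (auto simp: x_def)
  have e: "half_box_area k = x\<^sup>2 * (1 - 3 / 4 * x)"
    by (simp add: half_box_area_def x_def power2_eq_square field_simps)
  have x2: "x\<^sup>2 = 1 / 4 ^ k"
    by (simp add: x_def power_divide power2_eq_square flip: power_mult_distrib)
  have "x\<^sup>2 * (1 / 4) \<le> x\<^sup>2 * (1 - 3 / 4 * x)"
    using x by (intro mult_left_mono) auto
  then show ?thesis
    by (simp add: e x2)
qed

lemma box_area_powr_le:
  assumes "1 < t"
  shows "box_area k powr (1 - t) \<le> 2 powr ((2 * t - 2) * real k)"
proof -
  have "box_area k powr (1 - t) \<le> (1 / 4 ^ k) powr (1 - t)"
    using box_area_bounds(1)[of k] assms by (intro powr_mono2') auto
  also have "(1 / 4 ^ k :: real) = 2 powr (- 2 * real k)"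
    by (simp add: powr_minus_divide powr_realpow[symmetric] powr_powr[symmetric] flip: of_nat_mult)
  also have "(2 powr (- 2 * real k)) powr (1 - t) = 2 powr ((2 * t - 2) * real k)"
    by (simp add: powr_powr algebra_simps)
  finally show ?thesis .
qed

text \<open>
  With \<open>box_area_powr_le\<close>, this is where \<open>a = 2t - 2\<close> comes from: \<open>|Q|^(1-t)\<close> is comparable to
  \<open>4^(k(t-1)) = 2^(ak)\<close>.
\<close>
lemma half_box_area_div_ge:
  assumes "1 < t"
  shows "2 powr (- t) / 4 * 2 powr ((2 * t - 2) * real k) \<le> half_box_area k / box_area k powr t"
proof -
  have 4: "(1 / 4 ^ k :: real) = 2 powr (- 2 * real k)"
    by (simp add: powr_minus_divide powr_realpow[symmetric] powr_powr[symmetric] flip: of_nat_mult)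
  have "(2 / 4 ^ k) powr (- t) \<le> box_area k powr (- t)"
    using box_area_bounds(2)[of k] box_area_pos[of k] assms by (intro powr_mono2') auto
  moreover have "(2 / 4 ^ k :: real) = 2 powr (1 - 2 * real k)"
    using 4 by (simp add: powr_diff powr_minus_divide)
  ultimately have "2 powr (- t + 2 * t * real k) \<le> box_area k powr (- t)"
    by (simp add: powr_powr algebra_simps)
  with half_box_area_ge[of k] have "1 / 4 * 2 powr (- 2 * real k) * 2 powr (- t + 2 * t * real k) \<le> half_box_area k * box_area k powr (- t)"
    unfolding 4 by (intro mult_mono) (auto intro: order_trans[OF _ half_box_area_ge[unfolded 4]])
  also have "1 / 4 * 2 powr (- 2 * real k) * 2 powr (- t + 2 * t * real k) = 2 powr (- t) / 4 * 2 powr ((2 * t - 2) * real k)"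
    by (simp add: powr_add[symmetric] algebra_simps)
  finally show ?thesis
    by (simp add: powr_minus_divide)
qed

lemma sum_level_le:
  fixes a :: real
  assumes "0 < a"
  shows "(\<Sum>k\<le>n. 2 powr (a * real k)) \<le> 1 / (1 - 2 powr - a) * 2 powr (a * real n)"
proof -
  define q where "q = 2 powr a"
  have q: "1 < q" using assms by (simp add: q_def)
  have pw: "2 powr (a * real k) = q ^ k" for k
    using q by (simp add: q_def powr_powr[symmetric] powr_realpow)
  have "(\<Sum>k\<le>n. q ^ k) = (q ^ Suc n - 1) / (q - 1)"
    by (subst lessThan_Suc_atMost[symmetric], rule geometric_sum) (use q in simp)
  also have "\<dots> \<le> q ^ Suc n / (q - 1)"
    using q by (intro divide_right_mono) auto
  also have "\<dots> = 1 / (1 - 1 / q) * q ^ n"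
    using q by (simp add: field_simps)
  finally show ?thesis
    by (simp add: pw powr_minus_divide flip: q_def)
qed

text \<open>
  The generations of a dyadic system. What counts for integrals over the whole disc is that in each
  generation the arcs partition the circle and have equal length.
\<close>
locale dyadic_arcs =
  fixes Dk :: "nat \<Rightarrow> complex set set"
  assumes part: "partition_on unit_circle (Dk k)"
    and card_eq: "card (Dk k) = 2 ^ k"
    and arcs: "I \<in> Dk k \<Longrightarrow> circle_arc I"
    and len: "I \<in> Dk k \<Longrightarrow> arc_length I = 1 / 2 ^ k"
begin

lemma finite_Dk: "finite (Dk k)"
  using card_eq[of k] card_ge_0_finite[of "Dk k"] by simp

lemma box_eq_sector: "I \<in> Dk k \<Longrightarrow> carleson_box I = sector I (1 - 1 / 2 ^ k) 1"
  by (auto simp: carleson_box_def sector_def len)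

lemma sets_box [measurable]: "I \<in> Dk k \<Longrightarrow> carleson_box I \<in> sets disc_area"
  by (subst box_eq_sector) (auto intro!: sets_sector arcs)

lemma emeasure_box: "I \<in> Dk k \<Longrightarrow> emeasure disc_area (carleson_box I) = ennreal (box_area k)"
  by (subst box_eq_sector) (auto simp: emeasure_sector arcs len box_area_def)

lemma measure_box: "I \<in> Dk k \<Longrightarrow> measure disc_area (carleson_box I) = box_area k"
  using box_area_pos[of k] by (simp add: measure_def emeasure_box)

definition half_box :: "complex set \<Rightarrow> nat \<Rightarrow> complex set"
  where "half_box I k = sector I (1 - 1 / 2 ^ k) (1 - 1 / 2 ^ Suc k)"

lemma half_box_radii: "1 - 1 / 2 ^ k \<le> (1 - 1 / 2 ^ Suc k :: real)"
  by (simp add: field_simps)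

lemma sets_half_box [measurable]: "I \<in> Dk k \<Longrightarrow> half_box I k \<in> sets disc_area"
  unfolding half_box_def using half_box_radii[of k] by (intro sets_sector arcs) auto

lemma emeasure_half_box: "I \<in> Dk k \<Longrightarrow> emeasure disc_area (half_box I k) = ennreal (half_box_area k)"
  unfolding half_box_def half_box_area_def
  using half_box_radii[of k] by (subst emeasure_sector) (auto simp: arcs len)

lemma in_box_iff:
  assumes "I \<in> Dk k" "norm z < 1"
  shows "z \<in> carleson_box I \<longleftrightarrow> z / of_real (norm z) \<in> I \<and> k \<le> dyadic_level (norm z)"
  using assms by (auto simp: carleson_box_def len le_dyadic_level_iff)

lemma in_half_box_iff:
  assumes "I \<in> Dk k" "norm z < 1"
  shows "z \<in> half_box I k \<longleftrightarrow> z / of_real (norm z) \<in> I \<and> dyadic_level (norm z) = k"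
proof -
  have "dyadic_level (norm z) = k \<longleftrightarrow> k \<le> dyadic_level (norm z) \<and> \<not> Suc k \<le> dyadic_level (norm z)"
    by auto
  also have "\<dots> \<longleftrightarrow> 1 - 1 / 2 ^ k \<le> norm z \<and> norm z < 1 - 1 / 2 ^ Suc k"
    using assms(2) by (simp only: le_dyadic_level_iff norm_ge_zero not_le)
  finally show ?thesis
    by (simp add: half_box_def sector_def)
qed

lemma ex1_arc:
  assumes "z \<noteq> 0"
  shows "\<exists>!I. I \<in> Dk k \<and> z / of_real (norm z) \<in> I"
proof -
  have "z / of_real (norm z) \<in> unit_circle"
    using assms by (simp add: norm_divide)
  then have "z / of_real (norm z) \<in> \<Union> (Dk k)"
    using part[of k] by (simp only: partition_on_def)
  then obtain I where I: "I \<in> Dk k" "z / of_real (norm z) \<in> I"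
    by blast
  moreover have "J = I" if "J \<in> Dk k" "z / of_real (norm z) \<in> J" for J
    using part[of k] I that disjointD[of "Dk k" J I] by (auto simp: partition_on_def)
  ultimately show ?thesis by blast
qed

lemma sum_indicator_arcs:
  assumes "z \<noteq> 0"
  shows "(\<Sum>I\<in>Dk k. indicator I (z / of_real (norm z)) * c) = (c :: ennreal)"
proof -
  obtain J where J: "J \<in> Dk k" "z / of_real (norm z) \<in> J"
    and u: "\<And>I. I \<in> Dk k \<Longrightarrow> z / of_real (norm z) \<in> I \<Longrightarrow> I = J"
    using ex1_arc[OF assms, of k] by blast
  have "(\<Sum>I\<in>Dk k. indicator I (z / of_real (norm z)) * c) = (\<Sum>I\<in>Dk k. if I = J then c else 0)"
  proof (rule sum.cong[OF refl])
    fix I assume I: "I \<in> Dk k"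
    show "indicator I (z / of_real (norm z)) * c = (if I = J then c else 0)"
      using J(2) u[OF I] by (cases "z / of_real (norm z) \<in> I") auto
  qed
  then show ?thesis
    using J finite_Dk by simp
qed

text \<open>
  The boxes of one generation tile an annulus, and so do their upper halves. Only the origin, which
  lies in no box, has to be excluded.
\<close>
lemma AE_sum_box: "AE z in disc_area. (\<Sum>I\<in>Dk k. indicator (carleson_box I) z) = (indicator {..dyadic_level (norm z)} k :: ennreal)"
  using AE_disc_area_nonzero AE_space
proof eventually_elim
  case (elim z)
  have "(\<Sum>I\<in>Dk k. indicator (carleson_box I) z)
      = (\<Sum>I\<in>Dk k. indicator I (z / of_real (norm z)) * (indicator {..dyadic_level (norm z)} k :: ennreal))"
    using elim by (intro sum.cong) (auto simp: in_box_iff space_disc_area_iff split: split_indicator)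
  then show ?case
    using elim by (simp add: sum_indicator_arcs)
qed

lemma AE_sum_half_box: "AE z in disc_area. (\<Sum>I\<in>Dk k. indicator (half_box I k) z) = (indicator {dyadic_level (norm z)} k :: ennreal)"
  using AE_disc_area_nonzero AE_space
proof eventually_elim
  case (elim z)
  have "(\<Sum>I\<in>Dk k. indicator (half_box I k) z)
      = (\<Sum>I\<in>Dk k. indicator I (z / of_real (norm z)) * (indicator {dyadic_level (norm z)} k :: ennreal))"
    using elim by (intro sum.cong) (auto simp: in_half_box_iff space_disc_area_iff split: split_indicator)
  then show ?case
    using elim by (simp add: sum_indicator_arcs)
qed


end

section \<open>Size of the maximal function in the mean\<close>

context dyadic_arcs
begin

definition box_ratio :: "real \<Rightarrow> (complex \<Rightarrow> complex) \<Rightarrow> complex set \<Rightarrow> ennreal"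
  where "box_ratio t f I = (\<integral>\<^sup>+w \<in> carleson_box I. ennreal (norm (f w)) \<partial>disc_area)
        / ennreal (measure disc_area (carleson_box I) powr t)"

abbreviation maximal :: "real \<Rightarrow> (complex \<Rightarrow> complex) \<Rightarrow> complex \<Rightarrow> ennreal"
  where "maximal \<equiv> hypersingular_maximal (\<Union>k. Dk k)"

text \<open>
  As a countable supremum over all boxes, the maximal function is measurable.
\<close>
lemma maximal_alt:
  "maximal t f z = (SUP I\<in>(\<Union>k. Dk k). box_ratio t f I * indicator (carleson_box I) z)"
proof (rule antisym)
  show "maximal t f z \<le> (SUP I\<in>(\<Union>k. Dk k). box_ratio t f I * indicator (carleson_box I) z)"
    unfolding hypersingular_maximal_def box_ratio_def[symmetric]
  proof (rule SUP_least)
    fix I assume I: "I \<in> {I \<in> (\<Union>k. Dk k). z \<in> carleson_box I}"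
    then have "box_ratio t f I * indicator (carleson_box I) z \<le> (SUP I\<in>(\<Union>k. Dk k). box_ratio t f I * indicator (carleson_box I) z)"
      by (intro SUP_upper) blast
    with I show "box_ratio t f I \<le> (SUP I\<in>(\<Union>k. Dk k). box_ratio t f I * indicator (carleson_box I) z)"
      by simp
  qed
  show "(SUP I\<in>(\<Union>k. Dk k). box_ratio t f I * indicator (carleson_box I) z) \<le> maximal t f z"
  proof (rule SUP_least)
    fix I assume I: "I \<in> (\<Union>k. Dk k)"
    show "box_ratio t f I * indicator (carleson_box I) z \<le> maximal t f z"
    proof (cases "z \<in> carleson_box I")
      case True
      with I show ?thesis
        unfolding hypersingular_maximal_def box_ratio_def[symmetric]
        by (simp, intro SUP_upper) blast
    qed simp
  qed
qed

lemma borel_measurable_maximal: "maximal t f \<in> borel_measurable disc_area"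
proof -
  have "countable (\<Union>k. Dk k)"
    by (rule countable_UN) (simp_all add: countable_finite finite_Dk)
  then show ?thesis
    unfolding maximal_alt[abs_def]
    by (intro borel_measurable_SUP) (auto intro!: borel_measurable_times borel_measurable_indicator sets_box)
qed

lemma box_ratio_eq:
  assumes "I \<in> Dk k"
  shows "box_ratio t f I = (\<integral>\<^sup>+w \<in> carleson_box I. ennreal (norm (f w)) \<partial>disc_area) * ennreal (box_area k powr - t)"
  using box_area_pos[of k]
  by (simp add: box_ratio_def measure_box[OF assms] divide_ennreal_def powr_minus inverse_ennreal)

text \<open>
  The supremum is at most the sum over all boxes. A box \<open>Q\<close> of generation \<open>k\<close> contributes
  \<open>|Q|^(1-t)\<close> times the integral of \<open>|f|\<close> over \<open>Q\<close>. Summed over the boxes that contain a given point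
  of level \<open>n\<close>, the factors form a geometric series with ratio \<open>2^a > 1\<close>, and such a series is
  dominated by its last term \<open>2^(an)\<close>.
\<close>
lemma nn_integral_maximal_le:
  assumes t: "1 < t" and f [measurable]: "f \<in> borel_measurable disc_area"
  shows "(\<integral>\<^sup>+z. maximal t f z \<partial>disc_area)
    \<le> ennreal (1 / (1 - 2 powr - (2 * t - 2))) * (\<integral>\<^sup>+z. ennreal (norm (f z)) * level_weight (2 * t - 2) z \<partial>disc_area)"
proof -
  define g where "g z = ennreal (norm (f z))" for z
  have [measurable]: "g \<in> borel_measurable disc_area"
    unfolding g_def[abs_def] by measurable
  define a where "a = 2 * t - 2"
  have a: "0 < a" using t by (simp add: a_def)
  define K where "K = 1 / (1 - 2 powr - a)"
  have "(\<integral>\<^sup>+z. maximal t f z \<partial>disc_area)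
      \<le> (\<integral>\<^sup>+z. (\<Sum>k. \<Sum>I\<in>Dk k. box_ratio t f I * indicator (carleson_box I) z) \<partial>disc_area)"
  proof (rule nn_integral_mono)
    fix z
    show "maximal t f z \<le> (\<Sum>k. \<Sum>I\<in>Dk k. box_ratio t f I * indicator (carleson_box I) z)"
      unfolding maximal_alt
    proof (rule SUP_least)
      fix I assume "I \<in> (\<Union>k. Dk k)"
      then obtain k where k: "I \<in> Dk k" by blast
      have "box_ratio t f I * indicator (carleson_box I) z \<le> (\<Sum>I\<in>Dk k. box_ratio t f I * indicator (carleson_box I) z)"
        by (rule member_le_sum[OF k]) (auto simp: finite_Dk)
      also have "\<dots> = (\<Sum>k\<in>{k}. \<Sum>I\<in>Dk k. box_ratio t f I * indicator (carleson_box I) z)"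
        by simp
      also have "\<dots> \<le> (\<Sum>k. \<Sum>I\<in>Dk k. box_ratio t f I * indicator (carleson_box I) z)"
        by (rule sum_le_suminf) auto
      finally show "box_ratio t f I * indicator (carleson_box I) z \<le> (\<Sum>k. \<Sum>I\<in>Dk k. box_ratio t f I * indicator (carleson_box I) z)" .
    qed
  qed
  also have "\<dots> = (\<Sum>k. \<integral>\<^sup>+z. (\<Sum>I\<in>Dk k. box_ratio t f I * indicator (carleson_box I) z) \<partial>disc_area)"
    by (rule nn_integral_suminf) (auto intro!: borel_measurable_sum borel_measurable_times borel_measurable_indicator sets_box)
  also have "\<dots> = (\<Sum>k. ennreal (box_area k powr (1 - t)) * (\<integral>\<^sup>+w. g w * indicator {..dyadic_level (norm w)} k \<partial>disc_area))"
  proof (rule suminf_cong)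
    fix k
    have "(\<integral>\<^sup>+z. (\<Sum>I\<in>Dk k. box_ratio t f I * indicator (carleson_box I) z) \<partial>disc_area)
        = (\<Sum>I\<in>Dk k. box_ratio t f I * ennreal (box_area k))"
      by (subst nn_integral_sum)
         (auto intro!: sum.cong borel_measurable_times borel_measurable_indicator sets_box
           simp: nn_integral_cmult_indicator sets_box emeasure_box)
    also have "\<dots> = (\<Sum>I\<in>Dk k. ennreal (box_area k powr (1 - t)) * (\<integral>\<^sup>+w. g w * indicator (carleson_box I) w \<partial>disc_area))"
    proof (rule sum.cong[OF refl])
      fix I assume I: "I \<in> Dk k"
      have "ennreal (box_area k powr - t) * ennreal (box_area k) = ennreal (box_area k powr (1 - t))"
        using box_area_pos[of k] by (simp add: powr_diff powr_minus field_simps flip: ennreal_mult)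
      from this[symmetric] show "box_ratio t f I * ennreal (box_area k) = ennreal (box_area k powr (1 - t)) * (\<integral>\<^sup>+w. g w * indicator (carleson_box I) w \<partial>disc_area)"
        by (simp only: box_ratio_eq[OF I] g_def mult_ac)
    qed
    also have "\<dots> = ennreal (box_area k powr (1 - t)) * (\<integral>\<^sup>+w. g w * (\<Sum>I\<in>Dk k. indicator (carleson_box I) w) \<partial>disc_area)"
      by (simp add: sum_distrib_left[symmetric], subst nn_integral_sum[symmetric])
         (auto intro!: borel_measurable_times borel_measurable_indicator sets_box simp: sum_distrib_left)
    also have "(\<integral>\<^sup>+w. g w * (\<Sum>I\<in>Dk k. indicator (carleson_box I) w) \<partial>disc_area) = (\<integral>\<^sup>+w. g w * indicator {..dyadic_level (norm w)} k \<partial>disc_area)"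
      using AE_sum_box[of k] by (intro nn_integral_cong_AE) (auto elim!: eventually_rev_mp)
    finally show "(\<integral>\<^sup>+z. (\<Sum>I\<in>Dk k. box_ratio t f I * indicator (carleson_box I) z) \<partial>disc_area)
        = ennreal (box_area k powr (1 - t)) * (\<integral>\<^sup>+w. g w * indicator {..dyadic_level (norm w)} k \<partial>disc_area)" .
  qed
  also have "\<dots> = (\<integral>\<^sup>+w. (\<Sum>k. ennreal (box_area k powr (1 - t)) * (g w * indicator {..dyadic_level (norm w)} k)) \<partial>disc_area)"
    by (subst nn_integral_suminf) (simp_all add: nn_integral_cmult indicator_def)
  also have "\<dots> \<le> (\<integral>\<^sup>+w. ennreal K * (g w * level_weight a w) \<partial>disc_area)"
  proof (rule nn_integral_mono)
    fix w :: complex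
    let ?n = "dyadic_level (norm w)"
    have "(\<Sum>k. ennreal (box_area k powr (1 - t)) * (g w * indicator {..?n} k))
       = (\<Sum>k\<le>?n. ennreal (box_area k powr (1 - t)) * (g w * indicator {..?n} k))"
      by (rule suminf_finite) auto
    also have "\<dots> = (\<Sum>k\<le>?n. ennreal (box_area k powr (1 - t))) * g w"
      by (simp add: sum_distrib_right del: sum_ennreal)
    also have "\<dots> \<le> ennreal (K * 2 powr (a * real ?n)) * g w"
    proof (rule mult_right_mono)
      have "(\<Sum>k\<le>?n. ennreal (box_area k powr (1 - t))) = ennreal (\<Sum>k\<le>?n. box_area k powr (1 - t))"
        by simp
      also have "\<dots> \<le> ennreal (\<Sum>k\<le>?n. 2 powr (a * real k))"
        using box_area_powr_le[OF t] by (intro ennreal_leI sum_mono) (simp add: a_def)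
      also have "\<dots> \<le> ennreal (K * 2 powr (a * real ?n))"
        using sum_level_le[OF a, of ?n] by (intro ennreal_leI) (simp add: K_def)
      finally show "(\<Sum>k\<le>?n. ennreal (box_area k powr (1 - t))) \<le> ennreal (K * 2 powr (a * real ?n))" .
    qed simp
    also have "\<dots> = ennreal K * (g w * level_weight a w)"
    proof -
      have "2 powr (- a) < (1::real)"
        using a powr_less_mono[of "- a" 0 2] by simp
      then have "0 \<le> K" by (simp add: K_def)
      then show ?thesis
        by (simp add: level_weight_def ennreal_mult mult_ac)
    qed
    finally show "(\<Sum>k. ennreal (box_area k powr (1 - t)) * (g w * indicator {..?n} k)) \<le> ennreal K * (g w * level_weight a w)" .
  qed
  also have "\<dots> = ennreal K * (\<integral>\<^sup>+w. g w * level_weight a w \<partial>disc_area)"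
    by (rule nn_integral_cmult) measurable
  finally show ?thesis
    by (simp only: K_def a_def g_def)
qed

text \<open>
  Conversely, keep for each point only the smallest box that contains it. The upper half of a box
  \<open>Q\<close> has area comparable to that of \<open>Q\<close>, so \<open>Q\<close> contributes at least a multiple of \<open>|Q|^(1-t)\<close>
  times the integral of \<open>|f|\<close> over \<open>Q\<close>, of which only the part over the upper half is kept.
\<close>
lemma nn_integral_maximal_ge:
  assumes t: "1 < t" and f [measurable]: "f \<in> borel_measurable disc_area"
  shows "ennreal (2 powr - t / 4) * (\<integral>\<^sup>+z. ennreal (norm (f z)) * level_weight (2 * t - 2) z \<partial>disc_area)
    \<le> (\<integral>\<^sup>+z. maximal t f z \<partial>disc_area)"
proof -
  define g where "g z = ennreal (norm (f z))" for z
  have [measurable]: "g \<in> borel_measurable disc_area"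
    unfolding g_def[abs_def] by measurable
  define a where "a = 2 * t - 2"
  define c where "c = 2 powr - t / 4"
  have "ennreal c * (\<integral>\<^sup>+w. g w * level_weight a w \<partial>disc_area) = (\<integral>\<^sup>+w. ennreal c * (g w * level_weight a w) \<partial>disc_area)"
    by (rule nn_integral_cmult[symmetric]) measurable
  also have "\<dots> \<le> (\<integral>\<^sup>+w. (\<Sum>k. ennreal (half_box_area k * box_area k powr - t) * (g w * indicator {dyadic_level (norm w)} k)) \<partial>disc_area)"
  proof (rule nn_integral_mono)
    fix w :: complex
    let ?n = "dyadic_level (norm w)"
    have "ennreal c * (g w * level_weight a w) = ennreal (c * 2 powr (a * real ?n)) * g w"
      unfolding level_weight_def by (subst ennreal_mult) (simp_all add: c_def mult_ac)
    also have "\<dots> \<le> ennreal (half_box_area ?n * box_area ?n powr - t) * g w"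
      using half_box_area_div_ge[OF t, of ?n]
      by (intro mult_right_mono ennreal_leI) (simp_all add: c_def a_def powr_minus_divide)
    also have "\<dots> = (\<Sum>k\<in>{?n}. ennreal (half_box_area k * box_area k powr - t) * (g w * indicator {?n} k))"
      by simp
    also have "\<dots> \<le> (\<Sum>k. ennreal (half_box_area k * box_area k powr - t) * (g w * indicator {?n} k))"
      by (rule sum_le_suminf) auto
    finally show "ennreal c * (g w * level_weight a w) \<le> (\<Sum>k. ennreal (half_box_area k * box_area k powr - t) * (g w * indicator {?n} k))" .
  qed
  also have "\<dots> = (\<Sum>k. ennreal (half_box_area k * box_area k powr - t) * (\<integral>\<^sup>+w. g w * indicator {dyadic_level (norm w)} k \<partial>disc_area))"
    by (subst nn_integral_suminf) (simp_all add: nn_integral_cmult indicator_def)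
  also have "\<dots> \<le> (\<Sum>k. \<integral>\<^sup>+z. maximal t f z * indicator {dyadic_level (norm z)} k \<partial>disc_area)"
  proof (rule suminf_le)
    fix k
    have hb: "0 \<le> half_box_area k"
      by (rule order_trans[OF _ half_box_area_ge]) simp
    have "(\<integral>\<^sup>+w. g w * indicator {dyadic_level (norm w)} k \<partial>disc_area) = (\<integral>\<^sup>+w. (\<Sum>I\<in>Dk k. g w * indicator (half_box I k) w) \<partial>disc_area)"
      using AE_sum_half_box[of k] by (intro nn_integral_cong_AE) (auto elim!: eventually_rev_mp simp: sum_distrib_left[symmetric])
    also have "\<dots> = (\<Sum>I\<in>Dk k. \<integral>\<^sup>+w. g w * indicator (half_box I k) w \<partial>disc_area)"
      by (rule nn_integral_sum) (auto intro!: borel_measurable_times borel_measurable_indicator sets_half_box)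
    also have "\<dots> \<le> (\<Sum>I\<in>Dk k. \<integral>\<^sup>+w. g w * indicator (carleson_box I) w \<partial>disc_area)"
    proof (intro sum_mono nn_integral_mono mult_left_mono)
      fix I w assume "I \<in> Dk k" "w \<in> space disc_area"
      then show "indicator (half_box I k) w \<le> (indicator (carleson_box I) w :: ennreal)"
        by (auto simp: in_half_box_iff in_box_iff space_disc_area_iff split: split_indicator)
    qed simp
    finally have "ennreal (half_box_area k * box_area k powr - t) * (\<integral>\<^sup>+w. g w * indicator {dyadic_level (norm w)} k \<partial>disc_area)
        \<le> ennreal (half_box_area k * box_area k powr - t) * (\<Sum>I\<in>Dk k. \<integral>\<^sup>+w. g w * indicator (carleson_box I) w \<partial>disc_area)"
      by (rule mult_left_mono) simp
    also have "\<dots> = (\<Sum>I\<in>Dk k. box_ratio t f I * ennreal (half_box_area k))"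
      using hb by (simp add: sum_distrib_left box_ratio_eq g_def ennreal_mult mult_ac)
    also have "\<dots> = (\<integral>\<^sup>+z. (\<Sum>I\<in>Dk k. box_ratio t f I * indicator (half_box I k) z) \<partial>disc_area)"
      by (subst nn_integral_sum)
         (auto intro!: sum.cong borel_measurable_times borel_measurable_indicator sets_half_box
           simp: nn_integral_cmult_indicator sets_half_box emeasure_half_box)
    also have "\<dots> \<le> (\<integral>\<^sup>+z. (\<Sum>I\<in>Dk k. maximal t f z * indicator (half_box I k) z) \<partial>disc_area)"
    proof (intro nn_integral_mono sum_mono)
      fix I z assume I: "I \<in> Dk k" and z: "z \<in> space disc_area"
      show "box_ratio t f I * indicator (half_box I k) z \<le> maximal t f z * indicator (half_box I k) z"
      proof (cases "z \<in> half_box I k")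
        case True
        then have "z \<in> carleson_box I"
          using I z by (auto simp: in_half_box_iff in_box_iff space_disc_area_iff)
        then have "box_ratio t f I = box_ratio t f I * indicator (carleson_box I) z"
          by simp
        also have "\<dots> \<le> maximal t f z"
          unfolding maximal_alt using I by (intro SUP_upper) blast
        finally show ?thesis using True by simp
      qed simp
    qed
    also have "\<dots> = (\<integral>\<^sup>+z. maximal t f z * indicator {dyadic_level (norm z)} k \<partial>disc_area)"
      using AE_sum_half_box[of k] by (intro nn_integral_cong_AE) (auto elim!: eventually_rev_mp simp: sum_distrib_left[symmetric])
    finally show "ennreal (half_box_area k * box_area k powr - t) * (\<integral>\<^sup>+w. g w * indicator {dyadic_level (norm w)} k \<partial>disc_area)
        \<le> (\<integral>\<^sup>+z. maximal t f z * indicator {dyadic_level (norm z)} k \<partial>disc_area)" .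
  qed auto
  also have "\<dots> = (\<integral>\<^sup>+z. (\<Sum>k. maximal t f z * indicator {dyadic_level (norm z)} k) \<partial>disc_area)"
    using borel_measurable_maximal[of t f] by (subst nn_integral_suminf) (simp_all add: indicator_def)
  also have "\<dots> = (\<integral>\<^sup>+z. maximal t f z \<partial>disc_area)"
  proof (rule nn_integral_cong)
    fix z
    have "(\<Sum>k. maximal t f z * indicator {dyadic_level (norm z)} k) = (\<Sum>k\<in>{dyadic_level (norm z)}. maximal t f z * indicator {dyadic_level (norm z)} k)"
      by (rule suminf_finite) auto
    then show "(\<Sum>k. maximal t f z * indicator {dyadic_level (norm z)} k) = maximal t f z"
      by simp
  qed
  finally show ?thesis
    by (simp only: c_def a_def g_def)
qed

end

section \<open>Duality and general weights\<close>

lemma ennpowr_ennreal: "0 \<le> x \<Longrightarrow> ennpowr (ennreal x) a = ennreal (x powr a)"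
  by (simp add: ennpowr_def)

lemma ennpowr_one: "ennpowr x 1 = x"
  by (cases x) (auto simp: ennpowr_def)

lemma ennpowr_less_top_iff: "ennpowr x a < \<infinity> \<longleftrightarrow> x < \<infinity>"
  by (auto simp: ennpowr_def less_top)

lemma ennpowr_mono: "x \<le> y \<Longrightarrow> 0 \<le> a \<Longrightarrow> ennpowr x a \<le> ennpowr y a"
  by (auto simp: ennpowr_def top_unique less_top intro!: ennreal_leI powr_mono2 enn2real_mono)

lemma Lp_norm_unweighted_1: "Lp_norm 1 (\<lambda>_. 1) g = (\<integral>\<^sup>+z. g z \<partial>disc_area)"
  by (simp add: Lp_norm_def ennpowr_one)

text \<open>
  A form of Young's inequality with constants 1 and a free parameter \<open>\<mu>\<close>: according to the size of
  \<open>x\<close>, the left-hand side is bounded by one of the two terms. Where \<open>v = 0\<close> the dual weight is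
  infinite.
\<close>
lemma young_with_dual_weight:
  fixes a \<mu> W x v :: real
  assumes a: "0 < a" "a < 1" and \<mu>: "0 < \<mu>" and W: "0 < W" and x: "0 \<le> x" and v: "0 \<le> v"
  shows "ennreal (x * W powr a)
    \<le> ennreal \<mu> * (ennreal W * inverse (ennreal (v powr ((1 - a) / a))))
      + ennreal (\<mu> powr (- a / (1 - a))) * ennreal (x powr (1 / (1 - a)) * v)"
proof (cases "v = 0")
  case True
  then show ?thesis
    using \<mu> W by (simp add: ennreal_mult_top)
next
  case False
  with v have v: "0 < v" by simp
  define s where "s = (1 - a) / a"
  have s: "0 < s" using a by (simp add: s_def)
  have inv: "inverse (ennreal (v powr s)) = ennreal (v powr - s)"
    using v by (simp add: inverse_ennreal powr_minus)
  have "x * W powr a \<le> \<mu> * (W * v powr - s) + \<mu> powr (- a / (1 - a)) * (x powr (1 / (1 - a)) * v)"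
  \<comment> \<open>At this threshold for \<open>x\<close> the two terms on the right are equal.\<close>
  proof (cases "x \<le> \<mu> * (W powr (1 - a) * v powr - s)")
    case True
    then have "x * W powr a \<le> \<mu> * (W powr (1 - a) * v powr - s) * W powr a"
      by (intro mult_right_mono) auto
    also have "\<dots> = \<mu> * ((W powr (1 - a) * W powr a) * v powr - s)"
      by (simp add: mult_ac)
    also have "W powr (1 - a) * W powr a = W"
      using W by (simp flip: powr_add)
    finally show ?thesis
      using \<mu> v x by (intro order_trans[OF _ add_increasing2]) auto
  next
    case False
    then have "(\<mu> * (W powr (1 - a) * v powr - s)) powr (a / (1 - a)) \<le> x powr (a / (1 - a))"
      using a \<mu> W v by (intro powr_mono2) auto
    also have "(\<mu> * (W powr (1 - a) * v powr - s)) powr (a / (1 - a))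
       = \<mu> powr (a / (1 - a)) * (W powr a * v powr - 1)"
    proof -
      have "- s * (a / (1 - a)) = - 1" "(1 - a) * (a / (1 - a)) = a"
        using a by (simp_all add: s_def field_simps)
      then show ?thesis
        using \<mu> W v by (simp only: powr_mult powr_powr mult_nonneg_nonneg powr_ge_zero less_imp_le)
    qed
    finally have "\<mu> powr (a / (1 - a)) * (W powr a * v powr - 1) * (\<mu> powr (- a / (1 - a)) * v * x)
       \<le> x powr (a / (1 - a)) * (\<mu> powr (- a / (1 - a)) * v * x)"
      using \<mu> v x by (intro mult_right_mono) auto
    also have "\<mu> powr (a / (1 - a)) * (W powr a * v powr - 1) * (\<mu> powr (- a / (1 - a)) * v * x) = x * W powr a"
      using \<mu> v by (simp add: powr_minus field_simps)
    also have "x powr (a / (1 - a)) * (\<mu> powr (- a / (1 - a)) * v * x) = \<mu> powr (- a / (1 - a)) * (x powr (1 / (1 - a)) * v)"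
    proof (cases "x = 0")
      case False
      have "x powr (1 / (1 - a)) = x powr (a / (1 - a) + 1)"
        using a by (simp add: field_simps)
      then show ?thesis
        using False x by (simp add: powr_add mult_ac)
    qed simp
    finally show ?thesis
      using \<mu> W v by (intro order_trans[OF _ add_increasing]) auto
  qed
  then show ?thesis
    using \<mu> W v x unfolding s_def[symmetric] inv
    by (simp flip: ennreal_mult ennreal_plus add: ennreal_leI)
qed

text \<open>
  Hoelder's inequality up to a constant, for the exponents \<open>1 / (1 - a)\<close> and \<open>1 / a\<close>, with a dual
  weight that may take the value infinity.
\<close>
lemma nn_integral_dual_weight_le:
  fixes a :: real and x W v :: "'a \<Rightarrow> real"
  assumes a: "0 < a" "a < 1"
    and [measurable]: "x \<in> borel_measurable M" "W \<in> borel_measurable M" "v \<in> borel_measurable M"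
    and x: "\<And>z. z \<in> space M \<Longrightarrow> 0 \<le> x z" and W: "\<And>z. z \<in> space M \<Longrightarrow> 0 < W z"
    and v: "\<And>z. z \<in> space M \<Longrightarrow> 0 \<le> v z"
    and E: "(\<integral>\<^sup>+z. ennreal (W z) * inverse (ennreal (v z powr ((1 - a) / a))) \<partial>M) < \<infinity>" (is "?E < _")
    and A: "(\<integral>\<^sup>+z. ennreal (x z powr (1 / (1 - a)) * v z) \<partial>M) < \<infinity>" (is "?A < _")
  shows "(\<integral>\<^sup>+z. ennreal (x z * W z powr a) \<partial>M) \<le> (?E + 1) * ennpowr ?A (1 - a)" (is "?B \<le> _")
proof -
  obtain e where e: "?E = ennreal e" "0 \<le> e"
    using E by (cases ?E) auto
  obtain \<alpha> where \<alpha>: "?A = ennreal \<alpha>" "0 \<le> \<alpha>"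
    using A by (cases ?A) auto
  have B: "?B \<le> ennreal (\<mu> * e + \<mu> powr (- a / (1 - a)) * \<alpha>)" if \<mu>: "0 < \<mu>" for \<mu>
  proof -
    have "?B \<le> (\<integral>\<^sup>+z. ennreal \<mu> * (ennreal (W z) * inverse (ennreal (v z powr ((1 - a) / a))))
        + ennreal (\<mu> powr (- a / (1 - a))) * ennreal (x z powr (1 / (1 - a)) * v z) \<partial>M)"
      by (intro nn_integral_mono young_with_dual_weight a \<mu> x W v)
    also have "\<dots> = ennreal \<mu> * ?E + ennreal (\<mu> powr (- a / (1 - a))) * ?A"
      by (simp add: nn_integral_add nn_integral_cmult)
    also have "\<dots> = ennreal (\<mu> * e + \<mu> powr (- a / (1 - a)) * \<alpha>)"
      using \<mu> e \<alpha> by (simp add: ennreal_mult)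
    finally show ?thesis .
  qed
  show ?thesis
  proof (cases "\<alpha> = 0")
    case True
    obtain \<beta> where \<beta>: "?B = ennreal \<beta>" "0 \<le> \<beta>"
      using B[of 1] by (cases ?B) (auto simp: top_unique)
    \<comment> \<open>For \<open>\<alpha> = 0\<close> let \<open>\<mu>\<close> tend to \<open>0\<close>.\<close>
    have le: "\<beta> \<le> \<mu> * e" if "0 < \<mu>" for \<mu>
      using B[OF that] that e True \<beta> by (simp add: ennreal_le_iff)
    have "\<beta> = 0"
    proof (rule ccontr)
      assume "\<beta> \<noteq> 0"
      with \<beta> have "0 < \<beta>" by simp
      then have "\<beta> \<le> \<beta> / (2 * (e + 1)) * e"
        using e by (intro le) simp
      then have "\<beta> * 2 + \<beta> * e \<le> 0"
        using e by (simp add: field_simps)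
      then show False
        using \<open>0 < \<beta>\<close> mult_nonneg_nonneg[OF \<beta>(2) e(2)] by linarith
    qed
    then show ?thesis
      by (simp add: \<beta>)
  next
    case False
    \<comment> \<open>This choice makes \<open>\<mu>\<close> equal to the factor \<open>\<mu> powr (- a / (1 - a)) * \<alpha>\<close> of the second term.\<close>
    define \<mu> where "\<mu> = \<alpha> powr (1 - a)"
    have \<mu>: "0 < \<mu>" using False by (simp add: \<mu>_def)
    have "\<mu> powr (- a / (1 - a)) * \<alpha> = \<alpha> powr (- a) * \<alpha> powr 1"
      using a \<alpha> False by (simp add: \<mu>_def powr_powr)
    also have "\<dots> = \<mu>"
      unfolding \<mu>_def by (subst powr_add[symmetric]) simp
    finally have "?B \<le> ennreal ((e + 1) * \<mu>)"
      using B[OF \<mu>] by (simp add: algebra_simps)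
    also have "\<dots> = (?E + 1) * ennpowr ?A (1 - a)"
      using e \<alpha> \<mu> by (simp add: ennpowr_ennreal ennreal_mult \<mu>_def ennreal_plus)
    finally show ?thesis .
  qed
qed

lemma Lp_norm_norm:
  assumes "1 \<le> p" "\<And>z. z \<in> space disc_area \<Longrightarrow> 0 \<le> v z"
  shows "Lp_norm p v (\<lambda>z. ennreal (norm (f z)))
    = ennpowr (\<integral>\<^sup>+z. ennreal (norm (f z) powr p * v z) \<partial>disc_area) (1 / p)"
  using assms unfolding Lp_norm_def
  by (auto simp: ennpowr_ennreal ennreal_mult intro!: arg_cong2[where f = ennpowr] nn_integral_cong)

lemma level_weight_eq_powr:
  "level_weight a z = ennreal ((2 ^ dyadic_level (norm z)) powr a)"
  by (simp add: level_weight_def powr_realpow[symmetric] powr_powr mult.commute)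

text \<open>
  The norm of \<open>2^(a k)\<close> in the dual of the weighted space is a power of this integral, because
  \<open>(2^(a k))^(1/a) = 2^k\<close>.
\<close>
definition dual_energy :: "real \<Rightarrow> (complex \<Rightarrow> real) \<Rightarrow> ennreal"
  where "dual_energy s v = (\<integral>\<^sup>+z. ennreal (2 ^ dyadic_level (norm z)) * inverse (ennreal (v z powr s)) \<partial>disc_area)"

context dyadic_arcs
begin

lemma bounded_if_dual_energy_finite:
  fixes t :: real and v :: "complex \<Rightarrow> real"
  assumes t: "1 < t" "t < 3 / 2"
    and [measurable]: "v \<in> borel_measurable disc_area"
    and v: "\<And>z. z \<in> space disc_area \<Longrightarrow> 0 \<le> v z"
    and E: "dual_energy ((3 - 2 * t) / (2 * t - 2)) v < \<infinity>"
  shows "bounded_Lp_Lq (1 / (3 - 2 * t)) v 1 (maximal t)"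
proof -
  define a where "a = 2 * t - 2"
  have a: "0 < a" "a < 1" and at: "3 - 2 * t = 1 - a"
    using t by (auto simp: a_def)
  have p: "1 \<le> 1 / (1 - a)" using a by simp
  define K where "K = 1 / (1 - 2 powr - a)"
  obtain e where e: "dual_energy ((1 - a) / a) v = ennreal e" "0 \<le> e"
    using E unfolding at a_def[symmetric] by (cases "dual_energy ((1 - a) / a) v") auto
  show ?thesis
    unfolding bounded_Lp_Lq_def at
  proof (intro exI ballI conjI)
    fix f assume f: "f \<in> Lp_space (1 / (1 - a)) v"
    then have fm[measurable]: "f \<in> borel_measurable disc_area"
      by (simp add: Lp_space_def)
    show "maximal t f \<in> borel_measurable disc_area"
      by (rule borel_measurable_maximal)
    define A where "A = (\<integral>\<^sup>+z. ennreal (norm (f z) powr (1 / (1 - a)) * v z) \<partial>disc_area)"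
    have norm: "Lp_norm (1 / (1 - a)) v (\<lambda>z. ennreal (norm (f z))) = ennpowr A (1 - a)"
      using Lp_norm_norm[OF p v] by (simp add: A_def)
    have "A < \<infinity>"
      using f by (simp add: Lp_space_def norm ennpowr_less_top_iff[unfolded infinity_ennreal_def])
    have "(\<integral>\<^sup>+z. maximal t f z \<partial>disc_area)
      \<le> ennreal K * (\<integral>\<^sup>+z. ennreal (norm (f z)) * level_weight a z \<partial>disc_area)"
      using nn_integral_maximal_le[OF t(1) fm] by (simp only: K_def a_def)
    also have "(\<integral>\<^sup>+z. ennreal (norm (f z)) * level_weight a z \<partial>disc_area)
       = (\<integral>\<^sup>+z. ennreal (norm (f z) * (2 ^ dyadic_level (norm z)) powr a) \<partial>disc_area)"
      by (simp add: level_weight_eq_powr ennreal_mult)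
    also have "\<dots> \<le> (dual_energy ((1 - a) / a) v + 1) * ennpowr A (1 - a)"
      unfolding A_def dual_energy_def
    proof (rule nn_integral_dual_weight_le[OF a])
      show "(\<integral>\<^sup>+z. ennreal (2 ^ dyadic_level (norm z)) * inverse (ennreal (v z powr ((1 - a) / a))) \<partial>disc_area) < \<infinity>"
        using e by (simp add: dual_energy_def)
      show "(\<integral>\<^sup>+z. ennreal (norm (f z) powr (1 / (1 - a)) * v z) \<partial>disc_area) < \<infinity>"
        using \<open>A < \<infinity>\<close> by (simp only: A_def)
      show "(\<lambda>z. 2 ^ dyadic_level (norm z) :: real) \<in> borel_measurable disc_area"
        by (rule measurable_compose[OF measurable_dyadic_level_norm]) simp
    qed (auto intro: v)
    also have "ennreal K * ((dual_energy ((1 - a) / a) v + 1) * ennpowr A (1 - a)) = ennreal (K * (e + 1)) * ennpowr A (1 - a)"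
    proof -
      have "2 powr (- a) < (1::real)"
        using a powr_less_mono[of "- a" 0 2] by simp
      then have "0 \<le> K" by (simp add: K_def)
      then show ?thesis
        using e by (simp add: ennreal_mult mult.assoc)
    qed
    finally show "Lp_norm 1 (\<lambda>_. 1) (maximal t f) \<le> ennreal (K * (e + 1)) * Lp_norm (1 / (1 - a)) v (\<lambda>z. ennreal (norm (f z)))"
      by (simp add: Lp_norm_unweighted_1 norm mult_left_mono)
  qed
qed

text \<open>
  The extremal function \<open>W^(1-a) \<sigma>\<close> of the duality, where \<open>W = 2^k\<close> and \<open>\<sigma>\<close> is the dual weight, is
  tested after truncation: \<open>\<sigma>\<close> is cut at height \<open>n\<close>, which also copes with zeros of the weight, and
  the levels from \<open>n\<close> on are dropped. If \<open>x\<close> is the truncated energy, then boundedness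
  gives \<open>c x \<le> C x^(1-a)\<close>, which bounds \<open>x\<close> independently of \<open>n\<close>.
\<close>
lemma dual_energy_finite_if_bounded:
  fixes t :: real and v :: "complex \<Rightarrow> real"
  assumes t: "1 < t" "t < 3 / 2"
    and [measurable]: "v \<in> borel_measurable disc_area"
    and v: "\<And>z. z \<in> space disc_area \<Longrightarrow> 0 \<le> v z"
    and bdd: "bounded_Lp_Lq (1 / (3 - 2 * t)) v 1 (maximal t)"
  shows "dual_energy ((3 - 2 * t) / (2 * t - 2)) v < \<infinity>"
proof -
  define a where "a = 2 * t - 2"
  have a: "0 < a" "a < 1" and at: "3 - 2 * t = 1 - a"
    using t by (auto simp: a_def)
  have p: "1 \<le> 1 / (1 - a)" using a by simp
  define c where "c = 2 powr - t / 4"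
  have c: "0 < c" by (simp add: c_def)
  obtain C0 where C0: "\<And>f. f \<in> Lp_space (1 / (1 - a)) v \<Longrightarrow>
      Lp_norm 1 (\<lambda>_. 1) (maximal t f) \<le> ennreal C0 * Lp_norm (1 / (1 - a)) v (\<lambda>z. ennreal (norm (f z)))"
    using bdd unfolding bounded_Lp_Lq_def at by blast
  define C where "C = max C0 0"
  have C: "0 \<le> C" "\<And>y. ennreal C0 * y \<le> ennreal C * y"
    by (auto simp: C_def intro!: mult_right_mono ennreal_leI)
  define \<sigma> where "\<sigma> z = inverse (ennreal (v z powr ((1 - a) / a)))" for z
  have [measurable]: "\<sigma> \<in> borel_measurable disc_area"
    unfolding \<sigma>_def[abs_def] by measurable
  define W :: "complex \<Rightarrow> real" where "W z = 2 ^ dyadic_level (norm z)" for z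
  have W: "0 < W z" for z by (simp add: W_def)
  have [measurable]: "W \<in> borel_measurable disc_area"
    unfolding W_def[abs_def] by (rule measurable_compose[OF measurable_dyadic_level_norm]) simp
  define m where "m n z = enn2real (min (\<sigma> z) (of_nat n))" for n z
  have m_enn: "ennreal (m n z) = min (\<sigma> z) (of_nat n)" for n z
    unfolding m_def by (rule ennreal_enn2real, rule le_less_trans[OF min.cobounded2 of_nat_less_top])
  have m: "0 \<le> m n z" for n z by (simp add: m_def)
  have [measurable]: "m n \<in> borel_measurable disc_area" for n
    unfolding m_def[abs_def] by measurable
  define X where "X n z = W z * m n z * indicator {..<n} (dyadic_level (norm z))" for n z
  have ind [measurable]: "(\<lambda>z. indicator {..<n} (dyadic_level (norm z)) :: real) \<in> borel_measurable disc_area" for n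
    by (rule measurable_compose[OF measurable_dyadic_level_norm]) simp
  have [measurable]: "X n \<in> borel_measurable disc_area" for n
    unfolding X_def[abs_def] by (intro borel_measurable_times ind) measurable
  have bound: "(\<integral>\<^sup>+z. ennreal (X n z) \<partial>disc_area) \<le> ennreal ((C / c) powr (1 / a))" for n
  proof -
    define f where "f z = complex_of_real (W z powr (1 - a) * m n z * indicator {..<n} (dyadic_level (norm z)))" for z
    have "(\<lambda>z. W z powr (1 - a) * m n z * indicator {..<n} (dyadic_level (norm z))) \<in> borel_measurable disc_area"
      by (intro borel_measurable_times ind) measurable
    then have [measurable]: "f \<in> borel_measurable disc_area"
      unfolding f_def[abs_def] by (rule measurable_compose) simp
    have nf: "norm (f z) = W z powr (1 - a) * m n z * indicator {..<n} (dyadic_level (norm z))" for z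
      using m W by (simp add: f_def norm_mult)
    have "(\<integral>\<^sup>+z. ennreal (X n z) \<partial>disc_area) \<le> (\<integral>\<^sup>+z. ennreal (2 ^ n * real n) \<partial>disc_area)"
    proof (rule nn_integral_mono)
      fix z
      have "ennreal (m n z) \<le> ennreal (real n)"
        by (simp add: m_enn ennreal_of_nat_eq_real_of_nat)
      then have "m n z \<le> real n" by (simp add: ennreal_le_iff)
      then show "ennreal (X n z) \<le> ennreal (2 ^ n * real n)"
        using m by (auto intro!: ennreal_leI mult_mono power_increasing simp: X_def W_def split: split_indicator)
    qed
    also have "\<dots> < \<infinity>"
      using emeasure_disc_area_finite by (simp add: ennreal_mult_less_top)
    finally obtain x where x: "(\<integral>\<^sup>+z. ennreal (X n z) \<partial>disc_area) = ennreal x" "0 \<le> x"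
      by (cases "\<integral>\<^sup>+z. ennreal (X n z) \<partial>disc_area") auto
    have A: "(\<integral>\<^sup>+z. ennreal (norm (f z) powr (1 / (1 - a)) * v z) \<partial>disc_area) \<le> (\<integral>\<^sup>+z. ennreal (X n z) \<partial>disc_area)"
    proof (intro nn_integral_mono ennreal_leI)
      fix z assume z: "z \<in> space disc_area"
      \<comment> \<open>The truncation only decreases \<open>\<sigma>\<close>, and \<open>\<sigma>^(a / (1 - a)) v = 1\<close> where \<open>v > 0\<close>.\<close>
      have mv: "m n z powr (1 / (1 - a)) * v z \<le> m n z"
      proof (cases "v z = 0 \<or> m n z = 0")
        case False
        with v[OF z] m[of n z] have pos: "0 < v z" "0 < m n z" by auto
        have "\<sigma> z = ennreal (v z powr - ((1 - a) / a))"
          using pos by (simp add: \<sigma>_def inverse_ennreal powr_minus)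
        with m_enn[of n z] have "ennreal (m n z) \<le> ennreal (v z powr - ((1 - a) / a))"
          by simp
        then have "m n z \<le> v z powr - ((1 - a) / a)"
          by (simp add: ennreal_le_iff)
        then have "m n z powr (a / (1 - a)) \<le> (v z powr - ((1 - a) / a)) powr (a / (1 - a))"
          using a m by (intro powr_mono2) auto
        also have "\<dots> = v z powr - 1"
        proof -
          have "- ((1 - a) / a) * (a / (1 - a)) = - 1"
            using a by (simp add: field_simps)
          then show ?thesis by (simp only: powr_powr)
        qed
        finally have "m n z * (m n z powr (a / (1 - a)) * v z) \<le> m n z * (v z powr - 1 * v z)"
          using pos by (intro mult_left_mono mult_right_mono) auto
        moreover have "m n z powr (1 / (1 - a)) = m n z powr (1 + a / (1 - a))"
          using a by (simp add: field_simps)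
        ultimately show ?thesis
          using pos by (simp add: powr_add powr_minus)
      qed (use m v[OF z] in auto)
      have "norm (f z) powr (1 / (1 - a)) * v z
          = W z * (m n z powr (1 / (1 - a)) * v z) * indicator {..<n} (dyadic_level (norm z))"
        using a W[of z] m[of n z] by (simp add: nf powr_mult powr_powr split: split_indicator)
      also have "\<dots> \<le> X n z"
        unfolding X_def using mv W[of z] by (intro mult_right_mono mult_left_mono) auto
      finally show "norm (f z) powr (1 / (1 - a)) * v z \<le> X n z" .
    qed
    have norm: "Lp_norm (1 / (1 - a)) v (\<lambda>z. ennreal (norm (f z)))
        = ennpowr (\<integral>\<^sup>+z. ennreal (norm (f z) powr (1 / (1 - a)) * v z) \<partial>disc_area) (1 - a)"
      using Lp_norm_norm[OF p v] by simp
    have norm_le: "Lp_norm (1 / (1 - a)) v (\<lambda>z. ennreal (norm (f z))) \<le> ennreal (x powr (1 - a))"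
      unfolding norm ennpowr_ennreal[OF x(2), symmetric] x(1)[symmetric]
      using A a by (intro ennpowr_mono) auto
    have f: "f \<in> Lp_space (1 / (1 - a)) v"
      using norm_le by (simp add: Lp_space_def le_less_trans)
    have "ennreal c * ennreal x = ennreal c * (\<integral>\<^sup>+z. ennreal (norm (f z)) * level_weight a z \<partial>disc_area)"
      unfolding x(1)[symmetric]
    proof (intro arg_cong2[where f = "(*)"] refl nn_integral_cong)
      fix z
      have "X n z = norm (f z) * W z powr a"
        using W[of z] by (simp add: X_def nf mult_ac flip: powr_add)
      then show "ennreal (X n z) = ennreal (norm (f z)) * level_weight a z"
        by (simp add: level_weight_eq_powr W_def ennreal_mult)
    qed
    also have "\<dots> \<le> (\<integral>\<^sup>+z. maximal t f z \<partial>disc_area)"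
      using nn_integral_maximal_ge[OF t(1), of f] by (simp add: c_def a_def)
    also have "\<dots> \<le> ennreal C * ennreal (x powr (1 - a))"
      using C0[OF f] C(2) mult_left_mono[OF norm_le, of "ennreal C"]
      by (auto simp: Lp_norm_unweighted_1 intro: order_trans)
    finally have "c * x \<le> C * x powr (1 - a)"
      using c C x by (simp flip: ennreal_mult)
    have "x \<le> (C / c) powr (1 / a)"
    proof (cases "x = 0")
      case False
      with x have x0: "0 < x" by simp
      have "c * x powr a * x powr (1 - a) \<le> C * x powr (1 - a)"
        using \<open>c * x \<le> _\<close> x0 by (simp add: mult.assoc flip: powr_add)
      then have "x powr a \<le> C / c"
        using x0 c by (simp add: field_simps)
      then have "(x powr a) powr (1 / a) \<le> (C / c) powr (1 / a)"
        using a by (intro powr_mono2) auto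
      then show ?thesis
        using a x0 by (simp add: powr_powr)
    qed simp
    then show ?thesis
      by (simp add: x ennreal_leI)
  qed
  have "dual_energy ((1 - a) / a) v = (\<integral>\<^sup>+z. (SUP n. ennreal (X n z)) \<partial>disc_area)"
    unfolding dual_energy_def \<sigma>_def[symmetric]
  proof (rule nn_integral_cong)
    fix z
    have X_eq: "ennreal (X n z) = ennreal (W z) * (min (\<sigma> z) (of_nat n) * indicator {..<n} (dyadic_level (norm z)))" for n
      using W[of z] m[of n z] by (simp add: X_def ennreal_mult m_enn[symmetric] mult.assoc split: split_indicator)
    define S where "S = (SUP n. min (\<sigma> z) (of_nat n) * indicator {..<n} (dyadic_level (norm z)))"
    have "S = \<sigma> z"
    proof (rule antisym)
      show "S \<le> \<sigma> z"
        unfolding S_def by (rule SUP_least) (auto split: split_indicator)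
      show "\<sigma> z \<le> S"
      proof (rule ccontr)
        assume "\<not> \<sigma> z \<le> S"
        then have less: "S < \<sigma> z" by simp
        then have "S < top" by (rule less_le_trans) simp
        then obtain N where N: "S < of_nat N"
          using ennreal_Ex_less_of_nat by blast
        let ?n = "max N (Suc (dyadic_level (norm z)))"
        have "min (\<sigma> z) (of_nat N) \<le> min (\<sigma> z) (of_nat ?n) * indicator {..<?n} (dyadic_level (norm z))"
        proof -
          have "(of_nat N :: ennreal) \<le> of_nat ?n"
            by (rule of_nat_mono) simp
          then have "min (\<sigma> z) (of_nat N) \<le> min (\<sigma> z) (of_nat ?n)"
            by (rule min.mono[OF order_refl])
          moreover have "dyadic_level (norm z) \<in> {..<?n}"
            by simp
          ultimately show ?thesis
            by (simp only: indicator_simps mult_1_right)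
        qed
        also have "\<dots> \<le> S"
          unfolding S_def by (rule SUP_upper) simp
        finally show False
          using less N by (simp add: min_le_iff_disj not_le[symmetric])
      qed
    qed
    then show "ennreal (2 ^ dyadic_level (norm z)) * \<sigma> z = (SUP n. ennreal (X n z))"
      by (simp add: X_eq SUP_mult_left_ennreal[symmetric] S_def[symmetric] W_def)
  qed
  also have "\<dots> = (SUP n. \<integral>\<^sup>+z. ennreal (X n z) \<partial>disc_area)"
  proof (rule nn_integral_monotone_convergence_SUP)
    show "incseq (\<lambda>n z. ennreal (X n z))"
    proof (intro incseq_SucI le_funI ennreal_leI)
      fix n z
      have "m n z \<le> m (Suc n) z"
      proof -
        have "(of_nat n :: ennreal) \<le> of_nat (Suc n)"
          by (rule of_nat_mono) simp
        then have "ennreal (m n z) \<le> ennreal (m (Suc n) z)"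
          unfolding m_enn by (rule min.mono[OF order_refl])
        then show ?thesis
          using m by (simp add: ennreal_le_iff)
      qed
      then show "X n z \<le> X (Suc n) z"
        using W[of z] m by (auto simp: X_def split: split_indicator)
    qed
  qed measurable
  also have "\<dots> \<le> ennreal ((C / c) powr (1 / a))"
    by (rule SUP_least) (rule bound)
  also have "\<dots> < \<infinity>" by simp
  finally show ?thesis
    by (simp add: at flip: a_def)
qed

end

section \<open>Radial weights\<close>

lemma weight_on_measurable:
  fixes \<omega> :: "real \<Rightarrow> real"
  assumes "weight_on {0..<1} \<omega>"
  shows "(\<lambda>r. indicator {0..<1} r * \<omega> r) \<in> borel_measurable lebesgue"
proof (rule borel_measurable_LIMSEQ_real)
  show "(\<lambda>r. indicator {0..1 - 1 / real (Suc n)} r * \<omega> r) \<in> borel_measurable lebesgue" for n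
  proof -
    have "\<omega> absolutely_integrable_on {0..1 - 1 / real (Suc n)}"
    proof -
      have less: "1 - 1 / real (Suc n) < 1"
        by simp
      have "{0..1 - 1 / real (Suc n)} \<subseteq> {0..<1}"
        by (auto simp del: of_nat_Suc intro: le_less_trans[OF _ less])
      with assms show ?thesis
        unfolding weight_on_def by (blast intro: compact_Icc)
    qed
    then show ?thesis
      unfolding set_integrable_def by (auto dest: borel_measurable_integrable)
  qed
  show "(\<lambda>n. indicator {0..1 - 1 / real (Suc n)} r * \<omega> r) \<longlonglongrightarrow> indicator {0..<1} r * \<omega> r" for r :: real
  proof (cases "r < 1")
    case True
    then obtain N where N: "inverse (real (Suc N)) < 1 - r"
      using reals_Archimedean[of "1 - r"] by auto
    have "r \<le> 1 - 1 / real (Suc n)" if "N \<le> n" for n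
    proof -
      have "1 / real (Suc n) \<le> inverse (real (Suc N))"
        using that by (simp add: field_simps)
      with N show ?thesis by linarith
    qed
    then have "\<forall>\<^sub>F n in sequentially. indicator {0..1 - 1 / real (Suc n)} r * \<omega> r = indicator {0..<1} r * \<omega> r"
      using True by (intro eventually_sequentiallyI[of N]) (auto split: split_indicator)
    then show ?thesis
      by (rule tendsto_eventually)
  next
    case False
    then have "\<not> r \<le> 1 - 1 / real (Suc n)" for n
      by (auto simp: not_le intro: less_le_trans[of _ 1])
    then show ?thesis
      using False by simp
  qed
qed

lemma measurable_dyadic_level_lebesgue: "dyadic_level \<in> lebesgue \<rightarrow>\<^sub>M count_space UNIV"
  by (rule measurable_completion) (simp add: measurable_dyadic_level)

text \<open>
  The closed intervals of the series overlap in single points only.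
\<close>
lemma suminf_dyadic_layers:
  fixes F :: "real \<Rightarrow> ennreal"
  assumes F: "(\<lambda>r. indicator {0..<1} r * F r) \<in> borel_measurable lebesgue"
  shows "(\<Sum>k. 2 ^ k * (\<integral>\<^sup>+r \<in> {1 - 1 / 2 ^ k .. 1 - 1 / 2 ^ Suc k}. F r \<partial>lebesgue))
    = (\<integral>\<^sup>+r \<in> {0..<1}. ennreal (2 ^ dyadic_level r) * F r \<partial>lebesgue)"
proof -
  define G where "G r = indicator {0..<1} r * F r" for r :: real
  have G[measurable]: "G \<in> borel_measurable lebesgue"
    using F by (simp add: G_def[abs_def])
  have lev: "dyadic_level r = k \<longleftrightarrow> 1 - 1 / 2 ^ k \<le> r \<and> r < 1 - 1 / 2 ^ Suc k" if "r \<in> {0..<1}" for r k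
  proof -
    have "dyadic_level r = k \<longleftrightarrow> k \<le> dyadic_level r \<and> \<not> Suc k \<le> dyadic_level r"
      by auto
    with that show ?thesis
      by (simp only: le_dyadic_level_iff atLeastLessThan_iff not_le)
  qed
  have [measurable]: "(\<lambda>r. indicator {k} (dyadic_level r) :: ennreal) \<in> borel_measurable lebesgue" for k
    by (rule measurable_compose[OF measurable_dyadic_level_lebesgue]) simp
  have "2 ^ k * (\<integral>\<^sup>+r \<in> {1 - 1 / 2 ^ k .. 1 - 1 / 2 ^ Suc k}. F r \<partial>lebesgue)
      = (\<integral>\<^sup>+r. 2 ^ k * (G r * indicator {k} (dyadic_level r)) \<partial>lebesgue)" for k
  proof -
    have "(\<integral>\<^sup>+r \<in> {1 - 1 / 2 ^ k .. 1 - 1 / 2 ^ Suc k}. F r \<partial>lebesgue) = (\<integral>\<^sup>+r. G r * indicator {k} (dyadic_level r) \<partial>lebesgue)"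
    proof (rule nn_integral_cong_AE)
      have "AE r in lebesgue. r \<noteq> 1 - 1 / 2 ^ Suc k"
        by (rule AE_completion[OF AE_lborel_singleton])
      then show "AE r in lebesgue. F r * indicator {1 - 1 / 2 ^ k .. 1 - 1 / 2 ^ Suc k} r = G r * indicator {k} (dyadic_level r)"
      proof eventually_elim
        case (elim r)
        have ends: "(0::real) \<le> 1 - 1 / 2 ^ k" "1 - 1 / 2 ^ Suc k < (1::real)"
          by (simp_all add: field_simps)
        show ?case
        proof (cases "r \<in> {0..<1}")
          case True
          have "r \<in> {1 - 1 / 2 ^ k .. 1 - 1 / 2 ^ Suc k} \<longleftrightarrow> dyadic_level r \<in> {k}"
            unfolding singleton_iff lev[OF True] using elim by (simp only: atLeastAtMost_iff) linarith
          then show ?thesis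
            using True by (simp only: G_def indicator_def) simp
        next
          case False
          then have "r \<notin> {1 - 1 / 2 ^ k .. 1 - 1 / 2 ^ Suc k}"
            using ends by (simp only: atLeastAtMost_iff atLeastLessThan_iff) linarith
          with False show ?thesis
            by (simp only: G_def indicator_simps) simp
        qed
      qed
    qed
    then show ?thesis
      by (simp add: nn_integral_cmult)
  qed
  then have "(\<Sum>k. 2 ^ k * (\<integral>\<^sup>+r \<in> {1 - 1 / 2 ^ k .. 1 - 1 / 2 ^ Suc k}. F r \<partial>lebesgue))
      = (\<Sum>k. \<integral>\<^sup>+r. 2 ^ k * (G r * indicator {k} (dyadic_level r)) \<partial>lebesgue)"
    by simp
  also have "\<dots> = (\<integral>\<^sup>+r. (\<Sum>k. 2 ^ k * (G r * indicator {k} (dyadic_level r))) \<partial>lebesgue)"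
    by (subst nn_integral_suminf) auto
  also have "\<dots> = (\<integral>\<^sup>+r \<in> {0..<1}. ennreal (2 ^ dyadic_level r) * F r \<partial>lebesgue)"
  proof (rule nn_integral_cong)
    fix r :: real
    have "(\<Sum>k. 2 ^ k * (G r * indicator {k} (dyadic_level r))) = (\<Sum>k\<in>{dyadic_level r}. 2 ^ k * (G r * indicator {k} (dyadic_level r)))"
      by (rule suminf_finite) auto
    then show "(\<Sum>k. 2 ^ k * (G r * indicator {k} (dyadic_level r))) = ennreal (2 ^ dyadic_level r) * F r * indicator {0..<1} r"
      by (simp add: G_def mult_ac flip: ennreal_power)
  qed
  finally show ?thesis .
qed

text \<open>
  In polar coordinates the energy is the integral of the layered sum with the additional density
  \<open>2r\<close>. This density is at least \<open>1\<close> except on the layer of level \<open>0\<close>, where the lower bound on the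
  weight keeps the integral finite.
\<close>
lemma dual_energy_radial_finite_iff:
  fixes \<omega> :: "real \<Rightarrow> real"
  assumes s: "0 < s"
    and m: "(\<lambda>r. indicator {0..<1} r * \<omega> r) \<in> borel_measurable lebesgue"
    and c: "0 < c" "\<And>r. r \<in> {0..<1/2} \<Longrightarrow> c \<le> \<omega> r"
  shows "dual_energy s (\<lambda>z. \<omega> (norm z)) < \<infinity> \<longleftrightarrow>
    (\<Sum>k. 2 ^ k * (\<integral>\<^sup>+r \<in> {1 - 1 / 2 ^ k .. 1 - 1 / 2 ^ Suc k}. inverse (ennreal (\<omega> r powr s)) \<partial>lebesgue)) < \<infinity>"
proof -
  define \<sigma> where "\<sigma> r = inverse (ennreal (\<omega> r powr s))" for r
  define g where "g r = indicator {0..<1} r * \<sigma> r" for r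
  define W where "W r = ennreal (2 ^ dyadic_level r)" for r
  have [measurable]: "W \<in> borel_measurable lebesgue"
    unfolding W_def[abs_def] by (rule measurable_compose[OF measurable_dyadic_level_lebesgue]) simp
  have [measurable]: "g \<in> borel_measurable lebesgue"
  proof -
    have "(\<lambda>r. inverse (ennreal ((indicator {0..<1} r * \<omega> r) powr s))) \<in> borel_measurable lebesgue"
      by (rule measurable_compose[OF m]) measurable
    moreover have "indicator {0..<1} \<in> borel_measurable (lebesgue :: real measure)"
      by (rule borel_measurable_indicator) simp
    ultimately have "(\<lambda>r. indicator {0..<1} r * inverse (ennreal ((indicator {0..<1} r * \<omega> r) powr s))) \<in> borel_measurable lebesgue"
      by (intro borel_measurable_times_ennreal)
    also have "(\<lambda>r. indicator {0..<1} r * inverse (ennreal ((indicator {0..<1} r * \<omega> r) powr s))) = g"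
      by (auto simp: g_def \<sigma>_def split: split_indicator)
    finally show ?thesis .
  qed
  let ?S = "\<integral>\<^sup>+r \<in> {0..<1}. W r * \<sigma> r \<partial>lebesgue"
  let ?E = "\<integral>\<^sup>+r \<in> {0..<1}. W r * \<sigma> r * ennreal (2 * r) \<partial>lebesgue"
  have E: "dual_energy s (\<lambda>z. \<omega> (norm z)) = ?E"
  proof -
    have "dual_energy s (\<lambda>z. \<omega> (norm z)) = (\<integral>\<^sup>+z. W (norm z) * g (norm z) \<partial>disc_area)"
      unfolding dual_energy_def
      by (intro nn_integral_cong) (auto simp: W_def g_def \<sigma>_def space_disc_area split: split_indicator)
    also have "\<dots> = (\<integral>\<^sup>+r \<in> {0..<1}. W r * g r * ennreal (2 * r) \<partial>lebesgue)"
      by (rule nn_integral_disc_area_radial) measurable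
    also have "\<dots> = ?E"
      by (intro nn_integral_cong) (auto simp: g_def split: split_indicator)
    finally show ?thesis .
  qed
  have S: "(\<Sum>k. 2 ^ k * (\<integral>\<^sup>+r \<in> {1 - 1 / 2 ^ k .. 1 - 1 / 2 ^ Suc k}. \<sigma> r \<partial>lebesgue)) = ?S"
    unfolding W_def by (rule suminf_dyadic_layers) (simp add: g_def[symmetric])
  have "?E < \<infinity>" if "?S < \<infinity>"
  proof -
    have "?E \<le> (\<integral>\<^sup>+r. 2 * (W r * g r) \<partial>lebesgue)"
    proof (rule nn_integral_mono)
      fix r :: real
      show "W r * \<sigma> r * ennreal (2 * r) * indicator {0..<1} r \<le> 2 * (W r * g r)"
      proof (cases "r \<in> {0..<1}")
        case True
        then have "ennreal (2 * r) \<le> 2" by (simp flip: ennreal_numeral)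
        with True show ?thesis
          by (simp add: g_def mult.commute[of 2] mult_left_mono)
      qed simp
    qed
    also have "\<dots> = 2 * (\<integral>\<^sup>+r. W r * g r \<partial>lebesgue)"
      by (rule nn_integral_cmult) measurable
    also have "(\<integral>\<^sup>+r. W r * g r \<partial>lebesgue) = ?S"
      by (intro nn_integral_cong) (simp add: g_def mult_ac)
    also have "2 * ?S < \<infinity>"
      using that by (simp add: ennreal_mult_less_top)
    finally show ?thesis .
  qed
  moreover have "?S < \<infinity>" if "?E < \<infinity>"
  proof -
    let ?c = "ennreal (c powr - s)"
    have "?S \<le> (\<integral>\<^sup>+r. ?c * indicator {0..<1/2} r + W r * g r * ennreal (2 * r) \<partial>lebesgue)"
    proof (rule nn_integral_mono)
      fix r :: real
      consider "r \<notin> {0..<1}" | "r \<in> {0..<1/2}" | "r \<in> {1/2..<1}" by force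
      then show "W r * \<sigma> r * indicator {0..<1} r \<le> ?c * indicator {0..<1/2} r + W r * g r * ennreal (2 * r)"
      proof cases
        case 2
        have "\<not> 1 \<le> dyadic_level r"
          using 2 by (subst le_dyadic_level_iff) auto
        then have "dyadic_level r = 0" by linarith
        then have "W r = 1" by (simp add: W_def)
        have "\<sigma> r \<le> ?c"
        proof -
          have "\<omega> r powr - s \<le> c powr - s"
            using c s 2 by (intro powr_mono2') auto
          moreover have "0 < \<omega> r" using c 2 less_le_trans by blast
          ultimately show ?thesis
            by (simp add: \<sigma>_def inverse_ennreal powr_minus ennreal_leI)
        qed
        then show ?thesis
          using 2 \<open>W r = 1\<close> by (simp add: add_increasing2)
      next
        case 3
        then have "1 \<le> ennreal (2 * r)" by (simp flip: ennreal_1)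
        then have "W r * g r * 1 \<le> W r * g r * ennreal (2 * r)"
          by (rule mult_left_mono) simp
        with 3 show ?thesis by (simp add: g_def)
      qed simp
    qed
    also have "\<dots> = ?c * emeasure lebesgue {0..<1/2::real} + (\<integral>\<^sup>+r. W r * g r * ennreal (2 * r) \<partial>lebesgue)"
    proof (subst nn_integral_add)
      have "(\<lambda>r::real. ennreal (2 * r)) \<in> borel_measurable lebesgue"
        by (rule measurable_completion) simp
      then show "(\<lambda>r. W r * g r * ennreal (2 * r)) \<in> borel_measurable lebesgue"
        by (intro borel_measurable_times_ennreal) simp_all
      show "(\<lambda>r. ?c * indicator {0..<1/2::real} r) \<in> borel_measurable lebesgue"
        by (intro borel_measurable_times_ennreal borel_measurable_const borel_measurable_indicator) simp
      have "(\<integral>\<^sup>+r. ?c * indicator {0..<1/2::real} r \<partial>lebesgue) = ?c * emeasure lebesgue {0..<1/2::real}"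
        by (rule nn_integral_cmult_indicator) simp
      then show "(\<integral>\<^sup>+r. ?c * indicator {0..<1/2::real} r \<partial>lebesgue) + (\<integral>\<^sup>+r. W r * g r * ennreal (2 * r) \<partial>lebesgue)
          = ?c * emeasure lebesgue {0..<1/2::real} + (\<integral>\<^sup>+r. W r * g r * ennreal (2 * r) \<partial>lebesgue)"
        by simp
    qed
    also have "(\<integral>\<^sup>+r. W r * g r * ennreal (2 * r) \<partial>lebesgue) = ?E"
      by (intro nn_integral_cong) (simp add: g_def mult_ac)
    also have "?c * emeasure lebesgue {0..<1/2::real} + ?E < \<infinity>"
    proof -
      have "emeasure lebesgue {0..<1/2::real} = ennreal (1 / 2)"
        by simp
      then have "?c * emeasure lebesgue {0..<1/2::real} = ennreal (c powr - s * (1 / 2))"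
        by (simp only: ennreal_mult[OF powr_ge_zero])
      then show ?thesis
        using that by simp
    qed
    finally show ?thesis .
  qed
  ultimately show ?thesis
    unfolding E S[folded \<sigma>_def] \<sigma>_def[symmetric] by blast
qed

lemma dyadic_system_arcs:
  assumes "dyadic_system \<D>"
  obtains Dk where "dyadic_arcs Dk" "\<D> = (\<Union>k. Dk k)"
  using assms unfolding dyadic_system_def dyadic_arcs_def by metis

text \<open>
  The common source of both parts of the theorem: the constant weight is radial, too.
\<close>
lemma bounded_radial_iff:
  fixes t :: real and \<omega> :: "real \<Rightarrow> real"
  assumes t: "1 < t" "t < 3 / 2" and D: "dyadic_system \<D>"
    and m: "(\<lambda>r. indicator {0..<1} r * \<omega> r) \<in> borel_measurable lebesgue"
    and nonneg: "\<And>r. r \<in> {0..<1} \<Longrightarrow> 0 \<le> \<omega> r"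
    and c: "0 < c" "\<And>r. r \<in> {0..<1/2} \<Longrightarrow> c \<le> \<omega> r"
  shows "bounded_Lp_Lq (1 / (3 - 2 * t)) (\<lambda>z. \<omega> (norm z)) 1 (hypersingular_maximal \<D> t) \<longleftrightarrow>
        (\<Sum>k. 2 ^ k * (\<integral>\<^sup>+r \<in> {1 - 1 / 2 ^ k .. 1 - 1 / 2 ^ Suc k}.
            inverse (ennreal (\<omega> r powr ((3 - 2 * t) / (2 * t - 2)))) \<partial>lebesgue)) < \<infinity>"
proof -
  obtain Dk where Dk: "dyadic_arcs Dk" "\<D> = (\<Union>k. Dk k)"
    using dyadic_system_arcs[OF D] .
  interpret dyadic_arcs Dk by (rule Dk(1))
  have v: "(\<lambda>z. \<omega> (norm z)) \<in> borel_measurable disc_area"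
  proof -
    have "(\<lambda>z. indicator {0..<1} (norm z) * \<omega> (norm z)) \<in> borel_measurable disc_area"
      by (rule measurable_compose[OF measurable_polar_lebesgue(1) m])
    then show ?thesis
      by (subst measurable_cong[where g = "\<lambda>z. indicator {0..<1} (norm z) * \<omega> (norm z)"]) (auto simp: space_disc_area)
  qed
  have v0: "0 \<le> \<omega> (norm z)" if "z \<in> space disc_area" for z
    using that by (intro nonneg) (simp add: space_disc_area)
  have "bounded_Lp_Lq (1 / (3 - 2 * t)) (\<lambda>z. \<omega> (norm z)) 1 (maximal t) \<longleftrightarrow>
      dual_energy ((3 - 2 * t) / (2 * t - 2)) (\<lambda>z. \<omega> (norm z)) < \<infinity>"
    using bounded_if_dual_energy_finite[OF t v v0] dual_energy_finite_if_bounded[OF t v v0] by blast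
  also have "\<dots> \<longleftrightarrow> (\<Sum>k. 2 ^ k * (\<integral>\<^sup>+r \<in> {1 - 1 / 2 ^ k .. 1 - 1 / 2 ^ Suc k}.
            inverse (ennreal (\<omega> r powr ((3 - 2 * t) / (2 * t - 2)))) \<partial>lebesgue)) < \<infinity>"
    using t by (intro dual_energy_radial_finite_iff[OF _ m c]) auto
  finally show ?thesis
    by (simp only: Dk(2))
qed


section \<open>Characterization of boundedness\<close>

theorem theorem3p8:
  fixes t :: real and \<D> :: "complex set set"
  assumes "1 < t" and "t < 3 / 2"
    and "dyadic_system \<D>"
  shows "(\<forall>\<omega> :: real \<Rightarrow> real.
      weight_on {0..<1} \<omega> \<longrightarrow>
      (\<exists>c > 0. \<forall>r \<in> {0..<1/2}. c \<le> \<omega> r) \<longrightarrow>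
      (\<lambda>z. \<omega> (norm z)) \<in> bekolle_bonami (1 / (3 - 2 * t)) \<longrightarrow>
      (bounded_Lp_Lq (1 / (3 - 2 * t)) (\<lambda>z. \<omega> (norm z)) 1 (hypersingular_maximal \<D> t) \<longleftrightarrow>
        (\<Sum>k. 2 ^ k * (\<integral>\<^sup>+r \<in> {1 - 1 / 2 ^ k .. 1 - 1 / 2 ^ Suc k}.
            inverse (ennreal (\<omega> r powr ((3 - 2 * t) / (2 * t - 2)))) \<partial>lebesgue)) < \<infinity>))
    \<and> \<not> bounded_Lp_Lq (1 / (3 - 2 * t)) (\<lambda>_. 1) 1 (hypersingular_maximal \<D> t)"
proof (intro conjI allI impI)
  fix \<omega> :: "real \<Rightarrow> real"
  assume \<omega>: "weight_on {0..<1} \<omega>" and "\<exists>c > 0. \<forall>r \<in> {0..<1/2}. c \<le> \<omega> r"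
  then obtain c where "0 < c" "\<And>r. r \<in> {0..<1/2} \<Longrightarrow> c \<le> \<omega> r"
    by blast
  then show "bounded_Lp_Lq (1 / (3 - 2 * t)) (\<lambda>z. \<omega> (norm z)) 1 (hypersingular_maximal \<D> t) \<longleftrightarrow>
        (\<Sum>k. 2 ^ k * (\<integral>\<^sup>+r \<in> {1 - 1 / 2 ^ k .. 1 - 1 / 2 ^ Suc k}.
            inverse (ennreal (\<omega> r powr ((3 - 2 * t) / (2 * t - 2)))) \<partial>lebesgue)) < \<infinity>"
    using \<omega> by (intro bounded_radial_iff[OF assms weight_on_measurable[OF \<omega>]]) (auto simp: weight_on_def)
next
  let ?s = "(3 - 2 * t) / (2 * t - 2)"
  \<comment> \<open>For the constant weight every term of the series is \<open>1 / 2\<close>, so the series diverges.\<close>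
  have half: "2 ^ k * (\<integral>\<^sup>+r \<in> {1 - 1 / 2 ^ k .. 1 - 1 / 2 ^ Suc k :: real}. inverse (ennreal (1 powr ?s)) \<partial>lebesgue) = ennreal (1 / 2)" for k
  proof -
    have "(\<integral>\<^sup>+r \<in> {1 - 1 / 2 ^ k .. 1 - 1 / 2 ^ Suc k :: real}. inverse (ennreal (1 powr ?s)) \<partial>lebesgue)
        = ennreal (1 / 2 ^ k - 1 / 2 ^ Suc k)"
      by (simp add: nn_integral_cmult_indicator field_simps)
    moreover have "2 ^ k * ennreal (1 / 2 ^ k - 1 / 2 ^ Suc k) = ennreal (2 ^ k * (1 / 2 ^ k - 1 / 2 ^ Suc k))"
      by (subst ennreal_mult) (simp_all add: field_simps flip: ennreal_power)
    ultimately show ?thesis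
      by (simp add: field_simps)
  qed
  have "\<not> (\<Sum>k::nat. ennreal (1 / 2)) < \<infinity>"
  proof
    assume "(\<Sum>k::nat. ennreal (1 / 2)) < \<infinity>"
    then have "summable (\<lambda>k::nat. 1 / 2 :: real)"
      by (intro summable_suminf_not_top) auto
    then show False
      by (simp add: summable_const_iff)
  qed
  moreover have "bounded_Lp_Lq (1 / (3 - 2 * t)) (\<lambda>z. 1) 1 (hypersingular_maximal \<D> t) \<longleftrightarrow>
        (\<Sum>k. 2 ^ k * (\<integral>\<^sup>+r \<in> {1 - 1 / 2 ^ k .. 1 - 1 / 2 ^ Suc k :: real}. inverse (ennreal (1 powr ?s)) \<partial>lebesgue)) < \<infinity>"
    by (rule bounded_radial_iff[OF assms, where \<omega> = "\<lambda>_. 1" and c = 1]) (auto intro: borel_measurable_indicator)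
  ultimately show "\<not> bounded_Lp_Lq (1 / (3 - 2 * t)) (\<lambda>_. 1) 1 (hypersingular_maximal \<D> t)"
    unfolding half by blast
qed

end
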